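(* Let $Y$ be a separable Hilbert space with norm $\|\cdot\|_Y$, let $y\in Y$ and let $A:X\to Y$ be a bounded linear operator. Let $\mathcal I=\{I_k\}_{k\in\mathcal N}$ be a family of bounded closed intervals of $\mathbb R$ such that there exists $\omega>0$ with $[-\omega,\omega]\subset I_k$ for all $k\in\mathcal N$. Let $h(x)=\frac12\|Ax-y\|_Y^2$, let $L\in\left]0,+\infty\right[$ be such that $\nabla h$ is $L$-Lipschitz continuous, and let $f(x)=\|x\|_{1,\mathcal I}+h(x)$ for $x\in X$. Let $(x^n)_{n\in\mathbb N}$ be the sequence generated by the Forward-Backward algorithm (iterative soft-thresholding) applied to $f$: $$x^0\in X,\quad\lambda\in\left]0,2L^{-1}\right[,\quad x^{n+1}=\operatorname{prox}_{\lambda\|\cdot\|_{1,\mathcal I}}\big(x^n-\lambda\nabla h(x^n)\big).$$ Then $(x^n)_{n\in\mathbb N}$ converges strongly to some $\bar x\in\operatorname{argmin}f$, and there exist two constants $\varepsilon\in\left]0,1\right[$ and $C\in\left]0,+\infty\right[$, depending on $(\lambda,L,x^0,\mathcal I,A,y)$, such that for all $n\ge1$, $$f(x^n)-\inf f\le\varepsilon^n\big(f(x^0)-\inf f\big)\quad\text{and}\quad\|x^{n+1}-\bar x\|\le C\sqrt{\varepsilon}^{\,n}.$$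
   Context: $X$ is a real separable Hilbert space with inner product $\langle\cdot,\cdot\rangle$ and norm $\|\cdot\|$; $\mathcal N\subset\mathbb N$ and $(e_k)_{k\in\mathcal N}$ is an orthonormal basis of $X$; for $x\in X$, $x_k=\langle x,e_k\rangle$. $\|x\|_{1,\mathcal I}=\sum_{k\in\mathcal N}\sigma_{I_k}(x_k)\in\mathbb R\cup\{+\infty\}$, where $\sigma_I(t)=\sup_{s\in I}st$ is the support function of $I$. For a proper convex lower semicontinuous $g$ and $\lambda>0$, $\operatorname{prox}_{\lambda g}(x)$ is the unique minimizer of $y\mapsto g(y)+\frac1{2\lambda}\|y-x\|^2$. *)

theory Defs
  imports "HOL-Analysis.Analysis"
begin

text \<open>A family \<open>(e k)\<close> indexed by a (finite or infinite) set \<open>N\<close> of naturals; values of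
  \<open>e\<close> outside \<open>N\<close> are irrelevant.\<close>

definition orthonormal_basis :: "nat set \<Rightarrow> (nat \<Rightarrow> 'a::real_inner) \<Rightarrow> bool" where
  "orthonormal_basis N e \<longleftrightarrow>
     (\<forall>j\<in>N. \<forall>k\<in>N. e j \<bullet> e k = (if j = k then 1 else 0)) \<and>
     closure (span (e ` N)) = UNIV"

definition support_fun :: "real set \<Rightarrow> real \<Rightarrow> ereal" where
  "support_fun I t = (SUP s\<in>I. ereal (s * t))"

text \<open>When \<open>0 \<in> I k\<close> for all \<open>k \<in> N\<close>, all terms are nonnegative, so the infinite sum
  always exists in \<open>ereal\<close> (it is \<open>\<infinity>\<close> when the series diverges).\<close>

definition norm_1I ::
    "nat set \<Rightarrow> (nat \<Rightarrow> 'a::real_inner) \<Rightarrow> (nat \<Rightarrow> real set) \<Rightarrow> 'a \<Rightarrow> ereal" where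
  "norm_1I N e I x = (\<Sum>\<^sub>\<infinity>k\<in>N. support_fun (I k) (x \<bullet> e k))"

text \<open>The definite description is meaningful whenever the minimizer exists and is unique, in
  particular for \<open>g\<close> proper, convex and lower semicontinuous and \<open>lam > 0\<close>.\<close>

definition prox :: "real \<Rightarrow> ('a::real_normed_vector \<Rightarrow> ereal) \<Rightarrow> 'a \<Rightarrow> 'a" where
  "prox lam g x =
     (THE p. is_arg_min (\<lambda>z. g z + ereal (1 / (2 * lam) * (norm (z - x))\<^sup>2)) (\<lambda>_. True) p)"

definition gradient :: "('a::real_inner \<Rightarrow> real) \<Rightarrow> 'a \<Rightarrow> 'a" where
  "gradient h x = (THE D. GDERIV h x :> D)"

definition least_squares ::
    "('a::real_inner \<Rightarrow> 'b::real_inner) \<Rightarrow> 'b \<Rightarrow> 'a \<Rightarrow> real" where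
  "least_squares A y x = 1 / 2 * (norm (A x - y))\<^sup>2"

definition objective ::
    "nat set \<Rightarrow> (nat \<Rightarrow> 'a::real_inner) \<Rightarrow> (nat \<Rightarrow> real set) \<Rightarrow> ('a \<Rightarrow> 'b::real_inner) \<Rightarrow> 'b
      \<Rightarrow> 'a \<Rightarrow> ereal" where
  "objective N e I A y x = norm_1I N e I x + ereal (least_squares A y x)"

end

theory Submission
  imports Defs
begin

text \<open>
  Write \<open>G\<close> for the weighted \<open>\<ell>\<^sup>1\<close> norm and \<open>h\<close> for the least-squares term. The linear rate rests on
  two facts: all iterates after the starting point live in one finite-dimensional coordinate
  subspace, and on bounded subsets of such a subspace the objective grows at least like the squared
  distance to its minimizers.

  \<^bold>\<open>One subspace.\<close> The proximity operator acts on each coordinate as a soft threshold that kills every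
  value up to \<open>lam \<omega>\<close>, and a vector has only finitely many larger coordinates
  (\<open>finite_large_coords\<close>), so every iterate but the first has finite support
  (\<open>prox_subgradient\<close>). The descent inequality makes the steps tend to zero, and
  the basic inequality \<open>step_inequality\<close>, used for two iterates against each other, shows that
  the images \<open>A x\<^sup>n\<close> form a Cauchy sequence even before the iterates are known to converge
  (\<open>images_converge\<close>). Hence the gradients \<open>\<nabla>h(x\<^sup>n)\<close> converge, and all but finitely many of their
  coordinates eventually stay below \<open>\<omega>\<close>; such a coordinate of the iterate, once it is zero, is
  thresholded to zero for ever (\<open>support_identification\<close>).

  \<^bold>\<open>Growth.\<close> By compactness in that subspace the iterates have a cluster point \<open>z\<close>, and \<open>-\<nabla>h(z)\<close> is
  a subgradient of \<open>G\<close> at \<open>z\<close>, so \<open>z\<close> is a minimizer. The excess of the objective over its minimum is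
  then exactly a sum of nonnegative, positively homogeneous functions of single coordinates plus
  \<open>\<parallel>A u - A z\<parallel>\<^sup>2 / 2\<close> (\<open>excess_formula\<close>). The minimizers in the subspace form a polyhedron, and
  the required Hoffman-type error bound is obtained by a compactness argument
  (\<open>quadratic_growth\<close>).

  \<^bold>\<open>Rate.\<close> Comparing an iterate with a nearby minimizer in \<open>step_inequality\<close> bounds its excess by
  the squared length of the last step, which descent bounds by the decrease of the objective. So the
  excess contracts by a fixed factor \<open>\<epsilon>\<close>, the steps are bounded by a geometric sequence of ratio
  \<open>\<surd>\<epsilon>\<close>, and strong convergence follows by summation.
\<close>

section \<open>The gradient of the least-squares term\<close>

text \<open>
  Riesz representation. The representing vector is the minimizer of
  \<open>x \<mapsto> \<parallel>x\<parallel>\<^sup>2 / 2 - \<phi> x\<close>: by the parallelogram identity a minimizing sequence is Cauchy, and the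
  first-order condition at the limit is the claim.
\<close>

lemma bounded_linear_functional_eq_inner:
  fixes \<phi> :: "'a :: {real_inner, complete_space} \<Rightarrow> real"
  assumes "bounded_linear \<phi>"
  obtains u where "\<And>v. u \<bullet> v = \<phi> v"
proof -
  interpret \<phi>: bounded_linear \<phi> by fact
  define q where "q x = (norm x)\<^sup>2 / 2 - \<phi> x" for x
  obtain K where K: "\<And>x. norm (\<phi> x) \<le> norm x * K"
    using \<phi>.bounded by blast
  have q_lower: "- (K\<^sup>2) / 2 \<le> q x" for x
  proof -
    have "\<phi> x \<le> norm x * K" using K[of x] by simp
    moreover have "0 \<le> (norm x - K)\<^sup>2" by simp
    ultimately show ?thesis by (simp add: q_def power2_diff algebra_simps)
  qed
  define m where "m = (INF x. q x)"
  have bdd: "bdd_below (range q)" using q_lower by (intro bdd_belowI[of _ "- (K\<^sup>2) / 2"]) auto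
  have m_le: "m \<le> q x" for x unfolding m_def by (rule cINF_lower[OF bdd]) simp
  have "\<exists>x. q x < m + 1 / real (Suc n)" for n
  proof (rule ccontr)
    assume "\<not> ?thesis"
    then have "m + 1 / real (Suc n) \<le> m"
      unfolding m_def by (intro cINF_greatest) (auto simp: not_less)
    then show False by (simp add: field_simps)
  qed
  then obtain X where X: "\<And>n. q (X n) < m + 1 / real (Suc n)" by metis
  have midpoint: "(norm (x - z))\<^sup>2 / 8 = q x / 2 + q z / 2 - q ((1/2) *\<^sub>R (x + z))" for x z
    by (simp add: q_def power2_norm_eq_inner \<phi>.add \<phi>.scale inner_simps inner_commute[of z x]
        field_simps)
  have dist_X: "(norm (X i - X j))\<^sup>2 \<le> 4 * (1 / real (Suc i) + 1 / real (Suc j))" for i j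
    using midpoint[of "X i" "X j"] X[of i] X[of j] m_le[of "(1/2) *\<^sub>R (X i + X j)"]
    by (simp add: algebra_simps)
  have "Cauchy X"
  proof (rule CauchyI)
    fix d :: real assume "0 < d"
    obtain M where M: "8 / d\<^sup>2 < real (Suc M)"
      using reals_Archimedean2[of "8 / d\<^sup>2"] by (meson less_trans lessI of_nat_less_iff)
    have "norm (X i - X j) < d" if "M \<le> i" "M \<le> j" for i j
    proof -
      have "1 / real (Suc i) \<le> 1 / real (Suc M)" "1 / real (Suc j) \<le> 1 / real (Suc M)"
        using that by (auto intro!: divide_left_mono)
      then have "(norm (X i - X j))\<^sup>2 \<le> 8 / real (Suc M)" using dist_X[of i j] by simp
      also have "\<dots> < d\<^sup>2" using M \<open>0 < d\<close> by (simp add: field_simps)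
      finally show ?thesis using \<open>0 < d\<close> by (meson less_imp_le power2_less_imp_less)
    qed
    then show "\<exists>M. \<forall>i\<ge>M. \<forall>j\<ge>M. norm (X i - X j) < d" by blast
  qed
  then obtain u where u: "X \<longlonglongrightarrow> u" using Cauchy_convergent convergentD by blast
  have "(\<lambda>n. q (X n)) \<longlonglongrightarrow> q u"
    unfolding q_def by (intro tendsto_intros u \<phi>.tendsto) simp
  moreover have "(\<lambda>n. m + 1 / real (Suc n)) \<longlonglongrightarrow> m"
    using LIMSEQ_inverse_real_of_nat_add[of m] by (simp add: inverse_eq_divide)
  ultimately have "q u \<le> m" by (rule LIMSEQ_le) (use X in \<open>auto intro: less_imp_le\<close>)
  then have u_min: "q u \<le> q x" for x using m_le[of x] by linarith
  have "u \<bullet> v = \<phi> v" for v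
  proof -
    \<comment> \<open>The minimizing step is \<open>- s / (norm v)\<^sup>2\<close>; adding 1 to the denominator covers \<open>v = 0\<close>.\<close>
    define s where "s = u \<bullet> v - \<phi> v"
    define r where "r = (norm v)\<^sup>2 + 1"
    have "r > 0" by (simp add: r_def add_nonneg_pos)
    define t where "t = - s / r"
    have "q (u + t *\<^sub>R v) = q u + t * s + t\<^sup>2 * (r - 1) / 2"
      unfolding q_def s_def r_def power2_norm_eq_inner
      by (simp add: \<phi>.add \<phi>.scale inner_simps algebra_simps power2_eq_square inner_commute
          add_divide_distrib)
    then have "0 \<le> t * s + t\<^sup>2 * (r - 1) / 2" using u_min[of "u + t *\<^sub>R v"] by simp
    also have "\<dots> \<le> t * s + t\<^sup>2 * r / 2" by (simp add: divide_right_mono mult_left_mono)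
    also have "\<dots> = - s\<^sup>2 / (2 * r)"
      using \<open>r > 0\<close> by (simp add: t_def field_simps power2_eq_square)
    finally have "s\<^sup>2 \<le> 0" using \<open>r > 0\<close> by (simp add: field_simps)
    then show ?thesis by (simp add: s_def)
  qed
  then show thesis by (rule that)
qed

lemma bounded_linear_inner_comp:
  assumes "bounded_linear A" shows "bounded_linear (\<lambda>v. w \<bullet> A v)"
  using bounded_linear_compose[OF bounded_linear_inner_right assms] .

text \<open>
  The vector \<open>A\<^sup>*(A x - y)\<close>, in weak form: testing against \<open>v\<close> makes it possible to do without the adjoint of \<open>A\<close>.
\<close>

lemma gradient_least_squares_inner:
  fixes A :: "'a :: {real_inner, complete_space} \<Rightarrow> 'b :: real_inner"
  assumes A: "bounded_linear A"
  shows "gradient (least_squares A y) x \<bullet> v = (A x - y) \<bullet> A v"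
proof -
  obtain D where D: "\<And>v. D \<bullet> v = (A x - y) \<bullet> A v"
    using bounded_linear_functional_eq_inner[OF bounded_linear_inner_comp[OF A]] by blast
  have "((\<lambda>x. 1 / 2 * ((A x - y) \<bullet> (A x - y))) has_derivative
          (\<lambda>v. 1 / 2 * ((A x - y) \<bullet> A v + A v \<bullet> (A x - y)))) (at x)"
    by (auto intro!: derivative_eq_intros bounded_linear.has_derivative[OF A])
  then have "GDERIV (least_squares A y) x :> D"
    unfolding gderiv_def least_squares_def[abs_def] power2_norm_eq_inner
    by (simp add: inner_commute[of _ D] D inner_commute[of "A _" "A x - y"])
  moreover have "D' = D" if "GDERIV (least_squares A y) x :> D'" for D'
  proof -
    have "(\<lambda>h. h \<bullet> D') = (\<lambda>h. h \<bullet> D)"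
      using that \<open>GDERIV (least_squares A y) x :> D\<close> unfolding gderiv_def
      by (rule has_derivative_unique)
    then have "(D' - D) \<bullet> D' = (D' - D) \<bullet> D" by metis
    then have "(D' - D) \<bullet> (D' - D) = 0" by (simp add: inner_diff_right)
    then show ?thesis by simp
  qed
  ultimately have "gradient (least_squares A y) x = D"
    unfolding gradient_def by (rule the_equality)
  then show ?thesis by (simp add: D)
qed

lemma least_squares_expansion:
  assumes "bounded_linear A"
  shows "least_squares A y u =
    least_squares A y p + (A p - y) \<bullet> A (u - p) + 1 / 2 * (norm (A (u - p)))\<^sup>2"
proof -
  interpret A: bounded_linear A by fact
  show ?thesis unfolding least_squares_def power2_norm_eq_inner
    by (simp add: A.diff inner_simps inner_commute algebra_simps)
qed

section \<open>Expansions in an orthonormal basis\<close>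

locale hilbert_basis =
  fixes N :: "nat set" and e :: "nat \<Rightarrow> 'a :: real_inner"
  assumes basis: "orthonormal_basis N e"
begin

lemma inner_basis: "j \<in> N \<Longrightarrow> k \<in> N \<Longrightarrow> e j \<bullet> e k = (if j = k then 1 else 0)"
  using basis unfolding orthonormal_basis_def by blast

lemma norm_basis: "k \<in> N \<Longrightarrow> norm (e k) = 1"
  by (simp add: norm_eq_sqrt_inner inner_basis)

lemma abs_coord_le_norm: "k \<in> N \<Longrightarrow> \<bar>v \<bullet> e k\<bar> \<le> norm v"
  using Cauchy_Schwarz_ineq2[of v "e k"] by (simp add: norm_basis)

lemma inner_sum_basis:
  assumes "finite F" "F \<subseteq> N" "j \<in> N"
  shows "(\<Sum>k\<in>F. c k *\<^sub>R e k) \<bullet> e j = (if j \<in> F then c j else 0)"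
proof -
  have "(\<Sum>k\<in>F. c k *\<^sub>R e k) \<bullet> e j = (\<Sum>k\<in>F. if k = j then c k else 0)"
    unfolding inner_sum_left using assms by (intro sum.cong) (auto simp: inner_basis subset_iff)
  also have "\<dots> = (if j \<in> F then c j else 0)" using assms(1) by simp
  finally show ?thesis .
qed

text \<open>
  Density of the span gives a finite combination \<open>w\<close> close to \<open>v\<close>, and each partial sum over a larger
  index set is a better approximation, being the orthogonal projection of \<open>v\<close> onto a space that
  contains \<open>w\<close>.
\<close>

lemma has_sum_expansion: "((\<lambda>k. (v \<bullet> e k) *\<^sub>R e k) has_sum v) N"
  unfolding has_sum_def
proof (rule tendstoI)
  fix d :: real assume "0 < d"
  have "v \<in> closure (span (e ` N))" using basis by (simp add: orthonormal_basis_def)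
  then obtain w where w: "w \<in> span (e ` N)" "dist w v < d"
    using \<open>0 < d\<close> closure_approachable by blast
  then obtain t r where t: "finite t" "t \<subseteq> e ` N" "w = (\<Sum>a\<in>t. r a *\<^sub>R a)"
    by (auto simp: span_explicit)
  then obtain F0 where F0: "F0 \<subseteq> N" "finite F0" "t = e ` F0"
    using finite_subset_image[OF t(1,2)] by blast
  have "dist (\<Sum>k\<in>F. (v \<bullet> e k) *\<^sub>R e k) v < d" if F: "finite F" "F0 \<subseteq> F" "F \<subseteq> N" for F
  proof -
    define P where "P = (\<Sum>k\<in>F. (v \<bullet> e k) *\<^sub>R e k)"
    have "w \<in> span (e ` F)"
      unfolding t(3) F0(3) using F F0 by (intro span_sum span_scale span_base) auto
    moreover have "P \<in> span (e ` F)"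
      unfolding P_def by (intro span_sum span_scale span_base) simp
    ultimately have PW: "P - w \<in> span (e ` F)" by (rule span_diff[rotated])
    have "orthogonal (v - P) (P - w)"
    proof (rule orthogonal_to_span[OF PW])
      fix z assume "z \<in> e ` F"
      then obtain j where j: "j \<in> F" "z = e j" by blast
      have "P \<bullet> e j = v \<bullet> e j" unfolding P_def using F j by (subst inner_sum_basis) auto
      then show "orthogonal (v - P) z" by (simp add: orthogonal_def j inner_diff_left)
    qed
    then have "(norm (v - P + (P - w)))\<^sup>2 = (norm (v - P))\<^sup>2 + (norm (P - w))\<^sup>2"
      by (rule norm_add_Pythagorean)
    then have "(norm (v - P))\<^sup>2 \<le> (norm (v - w))\<^sup>2" by simp
    then have "norm (v - P) \<le> norm (v - w)" by (rule power2_le_imp_le) simp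
    then show ?thesis using w(2) unfolding P_def[symmetric] dist_norm
      by (metis norm_minus_commute le_less_trans)
  qed
  then show "\<forall>\<^sub>F F in finite_subsets_at_top N. dist (\<Sum>k\<in>F. (v \<bullet> e k) *\<^sub>R e k) v < d"
    unfolding eventually_finite_subsets_at_top using F0 by blast
qed

lemma expansion_finite_support:
  assumes "finite F" "F \<subseteq> N" "\<And>k. k \<in> N - F \<Longrightarrow> v \<bullet> e k = 0"
  shows "v = (\<Sum>k\<in>F. (v \<bullet> e k) *\<^sub>R e k)"
proof -
  have "((\<lambda>k. (v \<bullet> e k) *\<^sub>R e k) has_sum (\<Sum>k\<in>F. (v \<bullet> e k) *\<^sub>R e k)) N"
    by (rule has_sum_finite_neutralI) (use assms in auto)
  then show ?thesis using has_sum_expansion has_sum_unique by blast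
qed

lemma finite_large_coords:
  assumes "0 < d" shows "finite {k \<in> N. d \<le> \<bar>v \<bullet> e k\<bar>}"
proof -
  have "\<forall>\<^sub>F F in finite_subsets_at_top N. dist (\<Sum>k\<in>F. (v \<bullet> e k) *\<^sub>R e k) v < d"
    using has_sum_expansion assms unfolding has_sum_def by (rule tendstoD)
  then obtain F where F: "finite F" "F \<subseteq> N" "dist (\<Sum>k\<in>F. (v \<bullet> e k) *\<^sub>R e k) v < d"
    unfolding eventually_finite_subsets_at_top by blast
  have "\<bar>v \<bullet> e k\<bar> < d" if "k \<in> N - F" for k
  proof -
    have "\<bar>(v - (\<Sum>k\<in>F. (v \<bullet> e k) *\<^sub>R e k)) \<bullet> e k\<bar> < d"
      using abs_coord_le_norm[of k] F(3) that
      by (metis DiffD1 dist_norm norm_minus_commute order.strict_trans1)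
    then show ?thesis using that F by (simp add: inner_diff_left inner_sum_basis)
  qed
  then have "{k \<in> N. d \<le> \<bar>v \<bullet> e k\<bar>} \<subseteq> F" by force
  then show ?thesis using F(1) by (rule finite_subset)
qed

end

section \<open>Compactness for vectors with a common finite support\<close>

text \<open>
  Closed balls of a Hilbert space are compact only in finite dimension. The vectors supported in a
  fixed finite index set are determined by finitely many coordinates, so Bolzano-Weierstrass in each
  coordinate suffices.
\<close>

lemma finitely_many_bounded_convergent_subsequence:
  fixes c :: "'i \<Rightarrow> nat \<Rightarrow> real"
  assumes "finite J" "\<And>k. k \<in> J \<Longrightarrow> bounded (range (c k))"
  shows "\<exists>r. strict_mono r \<and> (\<forall>k\<in>J. convergent (\<lambda>n. c k (r n)))"
  using assms
proof (induction J rule: finite_induct)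
  case empty
  then show ?case by (auto intro: strict_mono_id)
next
  case (insert i J)
  then obtain r where r: "strict_mono r" "\<forall>k\<in>J. convergent (\<lambda>n. c k (r n))" by auto
  have "bounded (range (\<lambda>n. c i (r n)))"
    by (rule bounded_subset[of "range (c i)"]) (use insert.prems in auto)
  then obtain l s where s: "strict_mono s" "((\<lambda>n. c i (r n)) \<circ> s) \<longlonglongrightarrow> l"
    using bounded_imp_convergent_subsequence by blast
  have "convergent (\<lambda>n. c k ((r \<circ> s) n))" if "k \<in> insert i J" for k
  proof (cases "k = i")
    case True
    then show ?thesis using s(2) by (auto simp: o_def convergent_def)
  next
    case False
    then have "convergent (\<lambda>n. c k (r n))" using that r by blast
    from convergent_subseq_convergent[OF this s(1)] show ?thesis by (simp add: o_def)
  qed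
  then show ?case using strict_mono_o[OF r(1) s(1)] by blast
qed

context hilbert_basis
begin

definition supported :: "nat set \<Rightarrow> 'a set"
  where "supported J = {v. \<forall>k\<in>N - J. v \<bullet> e k = 0}"

lemma closed_supported: "closed (supported J)"
proof -
  have "supported J = (\<Inter>k\<in>N - J. {v. v \<bullet> e k = 0})" by (auto simp: supported_def)
  then show ?thesis
    by (simp add: closed_INT closed_Collect_eq continuous_on_inner continuous_on_id
        continuous_on_const)
qed

lemma supported_expansion:
  assumes "finite J" "J \<subseteq> N" "v \<in> supported J"
  shows "v = (\<Sum>k\<in>J. (v \<bullet> e k) *\<^sub>R e k)"
  by (rule expansion_finite_support) (use assms in \<open>auto simp: supported_def\<close>)

lemma supported_bounded_subsequence:
  assumes J: "finite J" "J \<subseteq> N" and X: "\<And>n. X n \<in> supported J" "\<And>n. norm (X n) \<le> R"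
  obtains r l where "strict_mono (r :: nat \<Rightarrow> nat)" "(\<lambda>n. X (r n)) \<longlonglongrightarrow> l" "l \<in> supported J"
proof -
  have "bounded (range (\<lambda>n. X n \<bullet> e k))" if "k \<in> J" for k
  proof (rule boundedI[of _ R])
    fix t assume "t \<in> range (\<lambda>n. X n \<bullet> e k)"
    then obtain n where "t = X n \<bullet> e k" by blast
    then show "norm t \<le> R" using abs_coord_le_norm[of k "X n"] X(2)[of n] that J by auto
  qed
  then obtain r where r: "strict_mono r" "\<forall>k\<in>J. convergent (\<lambda>n. X (r n) \<bullet> e k)"
    using finitely_many_bounded_convergent_subsequence[OF J(1), of "\<lambda>k n. X n \<bullet> e k"] by blast
  then obtain c where c: "\<And>k. k \<in> J \<Longrightarrow> (\<lambda>n. X (r n) \<bullet> e k) \<longlonglongrightarrow> c k"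
    unfolding convergent_def by metis
  have "(\<lambda>n. \<Sum>k\<in>J. (X (r n) \<bullet> e k) *\<^sub>R e k) \<longlonglongrightarrow> (\<Sum>k\<in>J. c k *\<^sub>R e k)"
    by (intro tendsto_sum tendsto_scaleR c tendsto_const)
  then have lim: "(\<lambda>n. X (r n)) \<longlonglongrightarrow> (\<Sum>k\<in>J. c k *\<^sub>R e k)"
    using supported_expansion[OF J X(1)] by simp
  have "(\<Sum>k\<in>J. c k *\<^sub>R e k) \<in> supported J"
    by (rule closed_sequentially[OF closed_supported _ lim]) (rule X)
  with r lim show thesis using that by blast
qed

lemma compact_supported_cball:
  assumes "finite J" "J \<subseteq> N"
  shows "compact (supported J \<inter> cball 0 R)"
  unfolding compact_eq_seq_compact_metric seq_compact_def
proof (intro allI impI)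
  fix X :: "nat \<Rightarrow> 'a" assume X: "\<forall>n. X n \<in> supported J \<inter> cball 0 R"
  obtain r l where rl: "strict_mono (r :: nat \<Rightarrow> nat)" "(\<lambda>n. X (r n)) \<longlonglongrightarrow> l" "l \<in> supported J"
    by (rule supported_bounded_subsequence[OF assms, of X R]) (use X in auto)
  have "l \<in> cball 0 R" by (rule closed_sequentially[OF closed_cball _ rl(2)]) (use X in auto)
  with rl show "\<exists>l\<in>supported J \<inter> cball 0 R. \<exists>r. strict_mono r \<and> (X \<circ> r) \<longlonglongrightarrow> l"
    by (auto simp: o_def)
qed

lemma supported_closest_point:
  assumes J: "finite J" "J \<subseteq> N" and S: "closed S" "S \<subseteq> supported J" "S \<noteq> {}"
  obtains p where "p \<in> S" "\<And>u. u \<in> S \<Longrightarrow> dist x p \<le> dist x u"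
proof -
  obtain s where s: "s \<in> S" using S by blast
  define R where "R = norm x + dist x s"
  define T where "T = S \<inter> cball x (dist x s)"
  have "T = (supported J \<inter> cball 0 R) \<inter> T"
  proof -
    have "norm u \<le> R" if "u \<in> T" for u
      using that norm_triangle_ineq2[of u x] unfolding T_def R_def
      by (simp add: dist_norm norm_minus_commute)
    then show ?thesis using S unfolding T_def by auto
  qed
  moreover have "closed T" unfolding T_def using S by auto
  ultimately have "compact T"
    using compact_Int_closed[OF compact_supported_cball[OF J]] by metis
  moreover have "s \<in> T" using s by (simp add: T_def)
  ultimately obtain p where p: "p \<in> T" "\<forall>u\<in>T. dist x p \<le> dist x u"
    using continuous_attains_inf[of T "dist x"] continuous_on_dist[OF continuous_on_const
        continuous_on_id] by blast
  have "dist x p \<le> dist x u" if "u \<in> S" for u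
  proof (cases "u \<in> T")
    case False
    then show ?thesis using that p(1) unfolding T_def by simp
  qed (use p in blast)
  then show thesis using p that T_def by blast
qed

end

section \<open>Quadratic growth\<close>

context hilbert_basis
begin

text \<open>
  A positively homogeneous function on the line that vanishes at \<open>p \<noteq> 0\<close> vanishes on the whole ray
  through \<open>p\<close>, hence also for arguments slightly to either side of \<open>p\<close>; at \<open>p = 0\<close> only the directions
  in which it vanishes are free. This is the only place where polyhedrality enters the error bound.
\<close>

lemma pos_homogeneous_zero_extends:
  fixes f :: "real \<Rightarrow> real"
  assumes hom: "\<And>s t. 0 \<le> s \<Longrightarrow> f (s * t) = s * f t" and zero: "f p = 0"
    and "p \<noteq> 0 \<or> f w = 0"
  shows "\<forall>\<^sub>F t in at_right 0. f (p + t * w) = 0"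
proof (cases "p = 0")
  case True
  then have "f (p + t * w) = 0" if "0 < t" for t using assms that by simp
  then show ?thesis by (auto simp: eventually_at_right_field intro: exI[of _ 1])
next
  case False
  have "((\<lambda>t. 1 + t * w / p) \<longlongrightarrow> 1 + 0 * w / p) (at_right 0)"
    using False by (intro tendsto_intros) auto
  then have "\<forall>\<^sub>F t in at_right 0. 0 < 1 + t * w / p" by (rule order_tendstoD) simp
  then show ?thesis
  proof eventually_elim
    case (elim t)
    have "p + t * w = (1 + t * w / p) * p" using False by (simp add: field_simps)
    then show ?case using hom[of "1 + t * w / p" p] elim zero by simp
  qed
qed

text \<open>
  The error bound behind the linear rate. If it fails, there are bounded \<open>X n\<close> in the subspace with
  \<open>E (X n) < (d n)\<^sup>2 / (n + 1)\<close>, where \<open>d n\<close> is the distance from \<open>X n\<close> to the zero set \<open>S\<close> of \<open>E\<close>.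
  With \<open>P n\<close> the point of \<open>S\<close> closest to \<open>X n\<close>, the unit vectors \<open>W n = (X n - P n) / d n\<close> cluster at some \<open>w\<close> of
  norm one. The smallness of \<open>E (X n)\<close> forces \<open>A w = 0\<close> and, for late \<open>n\<close> of the subsequence
  and each coordinate where \<open>P n\<close> vanishes, \<open>\<phi> k (w \<bullet> e k) = 0\<close>. So \<open>P n + t w\<close> remains in \<open>S\<close> for small \<open>t > 0\<close>, and as \<open>W n\<close> is almost
  \<open>w\<close>, this point is closer to \<open>X n\<close> than \<open>P n\<close> is.
\<close>

lemma quadratic_growth:
  fixes A :: "'a \<Rightarrow> 'b :: real_inner" and \<phi> :: "nat \<Rightarrow> real \<Rightarrow> real"
  assumes J: "finite J" "J \<subseteq> N" and A: "bounded_linear A"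
    and \<phi>_nonneg: "\<And>k t. k \<in> J \<Longrightarrow> 0 \<le> \<phi> k t"
    and \<phi>_hom: "\<And>k s t. k \<in> J \<Longrightarrow> 0 \<le> s \<Longrightarrow> \<phi> k (s * t) = s * \<phi> k t"
    and \<phi>_cont: "\<And>k. k \<in> J \<Longrightarrow> continuous_on UNIV (\<phi> k)"
    and z: "z \<in> supported J" "A z = c" "\<And>k. k \<in> J \<Longrightarrow> \<phi> k (z \<bullet> e k) = 0"
  obtains \<gamma> where "0 < \<gamma>"
    "\<And>x. x \<in> supported J \<Longrightarrow> norm x \<le> R \<Longrightarrow>
      \<exists>u \<in> supported J. A u = c \<and> (\<forall>k\<in>J. \<phi> k (u \<bullet> e k) = 0) \<and>
        \<gamma> * (norm (x - u))\<^sup>2 \<le> (\<Sum>k\<in>J. \<phi> k (x \<bullet> e k)) + 1 / 2 * (norm (A x - c))\<^sup>2"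
proof -
  interpret A: bounded_linear A by fact
  define S where "S = {u \<in> supported J. A u = c \<and> (\<forall>k\<in>J. \<phi> k (u \<bullet> e k) = 0)}"
  define E where "E x = (\<Sum>k\<in>J. \<phi> k (x \<bullet> e k)) + 1 / 2 * (norm (A x - c))\<^sup>2" for x
  have "\<exists>\<gamma>>0. \<forall>x. x \<in> supported J \<longrightarrow> norm x \<le> R \<longrightarrow> (\<exists>u\<in>S. \<gamma> * (norm (x - u))\<^sup>2 \<le> E x)"
  proof (rule ccontr)
    assume contr: "\<not> ?thesis"
    have "\<exists>x. x \<in> supported J \<and> norm x \<le> R \<and>
        (\<forall>u\<in>S. E x < 1 / real (Suc n) * (norm (x - u))\<^sup>2)" for n
      using contr[unfolded not_ex, rule_format, of "1 / real (Suc n)"] by (force simp: not_le)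
    then obtain X where X: "\<And>n. X n \<in> supported J" "\<And>n. norm (X n) \<le> R"
      "\<And>n u. u \<in> S \<Longrightarrow> E (X n) < 1 / real (Suc n) * (norm (X n - u))\<^sup>2" by metis
    have zS: "z \<in> S" using z by (simp add: S_def)
    have "closed S"
    proof -
      have "S = supported J \<inter> {u. A u = c} \<inter> (\<Inter>k\<in>J. {u. \<phi> k (u \<bullet> e k) = 0})"
        by (auto simp: S_def)
      moreover have "closed {u. \<phi> k (u \<bullet> e k) = 0}" if "k \<in> J" for k
        by (intro closed_Collect_eq continuous_on_const
            continuous_on_compose2[OF \<phi>_cont[OF that]] continuous_on_inner continuous_on_id) auto
      moreover have "closed {u. A u = c}"
        by (intro closed_Collect_eq continuous_on_const A.continuous_on continuous_on_id)
      ultimately show ?thesis by (auto intro!: closed_Int closed_INT closed_supported)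
    qed
    then have "\<exists>p\<in>S. \<forall>u\<in>S. dist (X n) p \<le> dist (X n) u" for n
    proof -
      have "S \<subseteq> supported J" "S \<noteq> {}" using zS by (auto simp: S_def)
      then obtain p where "p \<in> S" "\<And>u. u \<in> S \<Longrightarrow> dist (X n) p \<le> dist (X n) u"
        using supported_closest_point[OF J \<open>closed S\<close>, of "X n"] by blast
      then show ?thesis by blast
    qed
    then obtain P where P: "\<And>n. P n \<in> S" "\<And>n u. u \<in> S \<Longrightarrow> dist (X n) (P n) \<le> dist (X n) u"
      by metis
    define d where "d n = norm (X n - P n)" for n
    have E_lt: "E (X n) < (d n)\<^sup>2 / real (Suc n)" for n using X(3)[OF P(1)] by (simp add: d_def)
    have E_terms: "\<phi> k (X n \<bullet> e k) \<le> E (X n)" if "k \<in> J" for k n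
      unfolding E_def using member_le_sum[OF that, of "\<lambda>k. \<phi> k (X n \<bullet> e k)"] \<phi>_nonneg J(1)
      by (simp add: add_increasing2)
    have E_A: "(norm (A (X n) - c))\<^sup>2 \<le> 2 * E (X n)" for n
      unfolding E_def using sum_nonneg[of J "\<lambda>k. \<phi> k (X n \<bullet> e k)"] \<phi>_nonneg by simp
    have d_pos: "0 < d n" for n
    proof -
      have "0 \<le> E (X n)" using E_A[of n] zero_le_power2[of "norm (A (X n) - c)"] by linarith
      then have "0 < (d n)\<^sup>2 / real (Suc n)" using E_lt[of n] by linarith
      then have "d n \<noteq> 0" by auto
      then show ?thesis by (simp add: d_def)
    qed
    define B where "B = R + norm z"
    have d_le: "d n \<le> B" for n
      using P(2)[OF zS, of n] norm_triangle_ineq4[of "X n" z] X(2)[of n]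
      by (simp add: d_def B_def dist_norm)
    define W where "W n = (1 / d n) *\<^sub>R (X n - P n)" for n
    have XW: "X n = P n + d n *\<^sub>R W n" for n using d_pos[of n] by (simp add: W_def)
    have W_supp: "W n \<in> supported J" for n
      using X(1)[of n] P(1)[of n] by (auto simp: W_def S_def supported_def inner_diff_left)
    have norm_W: "norm (W n) = 1" for n using d_pos[of n] by (simp add: W_def d_def)
    obtain r w where r: "strict_mono (r :: nat \<Rightarrow> nat)" and w: "(\<lambda>n. W (r n)) \<longlonglongrightarrow> w"
      "w \<in> supported J"
      by (rule supported_bounded_subsequence[OF J, of W 1]) (use W_supp norm_W in auto)
    have to_zero: "(\<lambda>n. C / real (Suc (r n))) \<longlonglongrightarrow> 0" for C :: real
    proof -
      have "(\<lambda>n. C * inverse (real (Suc n))) \<longlonglongrightarrow> C * 0"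
        by (intro tendsto_intros LIMSEQ_inverse_real_of_nat)
      from LIMSEQ_subseq_LIMSEQ[OF this r] show ?thesis
        by (simp add: o_def inverse_eq_divide)
    qed
    have "norm w = 1" using tendsto_norm[OF w(1)] by (simp add: norm_W LIMSEQ_const_iff)
    have "A w = 0"
    proof -
      have "(norm (A (W n)))\<^sup>2 \<le> 2 / real (Suc n)" for n
      proof -
        have "A (X n) - c = d n *\<^sub>R A (W n)"
          using P(1)[of n] by (subst XW) (simp add: A.add A.scale S_def)
        then have "(d n)\<^sup>2 * (norm (A (W n)))\<^sup>2 \<le> 2 * ((d n)\<^sup>2 / real (Suc n))"
          using E_A[of n] E_lt[of n] by (simp add: power_mult_distrib)
        then have "(d n)\<^sup>2 * (norm (A (W n)))\<^sup>2 \<le> (d n)\<^sup>2 * (2 / real (Suc n))"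
          by (simp add: mult_ac)
        then show ?thesis using d_pos[of n] by (subst (asm) mult_le_cancel_left_pos) auto
      qed
      moreover have "(\<lambda>n. (norm (A (W (r n))))\<^sup>2) \<longlonglongrightarrow> (norm (A w))\<^sup>2"
        by (intro tendsto_intros A.tendsto w)
      ultimately have "(norm (A w))\<^sup>2 \<le> 0" using to_zero[of 2] by (intro LIMSEQ_le) auto
      then show ?thesis by simp
    qed
    \<comment> \<open>Dividing \<open>\<phi> k (X n \<bullet> e k) \<le> E (X n)\<close> by \<open>d n\<close> loses only one of the two factors \<open>d n\<close>, so where
      \<open>P n\<close> vanishes the quotient \<open>\<phi> k (W n \<bullet> e k)\<close> is at most \<open>B / (n + 1)\<close>.\<close>
    have coord_ev: "\<forall>\<^sub>F n in sequentially. P (r n) \<bullet> e k \<noteq> 0 \<or> \<phi> k (w \<bullet> e k) = 0"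
      if k: "k \<in> J" for k
    proof (cases "\<phi> k (w \<bullet> e k) = 0")
      case False
      have "(\<lambda>n. W (r n) \<bullet> e k) \<longlonglongrightarrow> w \<bullet> e k" by (intro tendsto_intros w)
      then have "(\<lambda>n. \<phi> k (W (r n) \<bullet> e k)) \<longlonglongrightarrow> \<phi> k (w \<bullet> e k)"
        by (rule continuous_on_tendsto_compose[OF \<phi>_cont[OF k]]) auto
      from tendsto_diff[OF this to_zero[of B]]
      have "\<forall>\<^sub>F n in sequentially. 0 < \<phi> k (W (r n) \<bullet> e k) - B / real (Suc (r n))"
        by (rule order_tendstoD) (use False \<phi>_nonneg[OF k, of "w \<bullet> e k"] in simp)
      then show ?thesis
      proof eventually_elim
        case (elim n)
        have "P (r n) \<bullet> e k \<noteq> 0"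
        proof
          assume "P (r n) \<bullet> e k = 0"
          then have "\<phi> k (X (r n) \<bullet> e k) = d (r n) * \<phi> k (W (r n) \<bullet> e k)"
            using \<phi>_hom[OF k, of "d (r n)" "W (r n) \<bullet> e k"] d_pos[of "r n"]
            by (subst XW) (simp add: inner_add_left less_imp_le)
          then have "d (r n) * \<phi> k (W (r n) \<bullet> e k) \<le> d (r n) * (d (r n) / real (Suc (r n)))"
            using E_terms[OF k, of "r n"] E_lt[of "r n"] by (simp add: power2_eq_square)
          then have "\<phi> k (W (r n) \<bullet> e k) \<le> d (r n) / real (Suc (r n))"
            using d_pos[of "r n"] mult_le_cancel_left_pos by blast
          also have "\<dots> \<le> B / real (Suc (r n))" using d_le by (simp add: divide_right_mono)
          finally show False using elim by simp
        qed
        then show ?case ..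
      qed
    qed simp
    have "(\<lambda>n. W (r n) \<bullet> w) \<longlonglongrightarrow> w \<bullet> w" by (intro tendsto_intros w)
    then have "\<forall>\<^sub>F n in sequentially. 1 / 2 < W (r n) \<bullet> w"
      by (rule order_tendstoD)
        (use \<open>norm w = 1\<close> in \<open>simp add: power2_norm_eq_inner[symmetric]\<close>)
    moreover have "\<forall>\<^sub>F n in sequentially. \<forall>k\<in>J. P (r n) \<bullet> e k \<noteq> 0 \<or> \<phi> k (w \<bullet> e k) = 0"
      using coord_ev J(1) by (simp add: eventually_ball_finite_distrib)
    ultimately have "\<forall>\<^sub>F n in sequentially. 1 / 2 < W (r n) \<bullet> w \<and>
        (\<forall>k\<in>J. P (r n) \<bullet> e k \<noteq> 0 \<or> \<phi> k (w \<bullet> e k) = 0)"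
      by (rule eventually_conj)
    then obtain m where m: "1 / 2 < W m \<bullet> w"
      "\<And>k. k \<in> J \<Longrightarrow> P m \<bullet> e k \<noteq> 0 \<or> \<phi> k (w \<bullet> e k) = 0"
      unfolding eventually_sequentially by blast
    have "\<forall>\<^sub>F t in at_right 0. \<forall>k\<in>J. \<phi> k (P m \<bullet> e k + t * (w \<bullet> e k)) = 0"
    proof (rule eventually_ball_finite[OF J(1)], rule ballI)
      fix k assume k: "k \<in> J"
      show "\<forall>\<^sub>F t in at_right 0. \<phi> k (P m \<bullet> e k + t * (w \<bullet> e k)) = 0"
        by (rule pos_homogeneous_zero_extends[OF \<phi>_hom[OF k] _ m(2)[OF k]])
          (use P(1)[of m] k in \<open>auto simp: S_def\<close>)
    qed
    \<comment> \<open>Moving from \<open>P m\<close> by \<open>t w\<close> decreases the distance to \<open>X m\<close> as long as \<open>0 < t < 2 d (W m \<bullet> w)\<close>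
      with \<open>d = d m\<close>, and \<open>W m \<bullet> w > 1 / 2\<close>.\<close>
    moreover have "\<forall>\<^sub>F t in at_right 0. t \<in> {0<..<d m}"
      using d_pos by (rule eventually_at_right_real)
    ultimately have "\<forall>\<^sub>F t in at_right 0. t \<in> {0<..<d m} \<and>
        (\<forall>k\<in>J. \<phi> k (P m \<bullet> e k + t * (w \<bullet> e k)) = 0)" by (simp add: eventually_conj_iff)
    then obtain t where t: "0 < t" "t < d m" "\<forall>k\<in>J. \<phi> k (P m \<bullet> e k + t * (w \<bullet> e k)) = 0"
      using eventually_happens[of _ "at_right (0 :: real)"] by auto
    have "P m + t *\<^sub>R w \<in> S"
      using P(1)[of m] w(2) t(3) \<open>A w = 0\<close>
      by (auto simp: S_def supported_def A.add A.scale inner_add_left)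
    then have "norm (d m *\<^sub>R W m) \<le> norm (d m *\<^sub>R W m - t *\<^sub>R w)"
      using P(2)[of "P m + t *\<^sub>R w" m] XW[of m] unfolding dist_norm
      by (metis add_diff_cancel_left add_diff_cancel_left')
    then have "(norm (d m *\<^sub>R W m))\<^sup>2 \<le> (norm (d m *\<^sub>R W m - t *\<^sub>R w))\<^sup>2"
      by (intro power_mono) auto
    also have "\<dots> = (norm (d m *\<^sub>R W m))\<^sup>2 - t * (2 * d m * (W m \<bullet> w) - t * (norm w)\<^sup>2)"
      unfolding power2_norm_eq_inner
      by (simp add: inner_simps inner_commute[of w "W m"] algebra_simps)
    finally have "t * (2 * d m * (W m \<bullet> w) - t) \<le> 0" by (simp add: \<open>norm w = 1\<close>)
    then have "2 * d m * (W m \<bullet> w) \<le> t" using t(1) by (simp add: mult_le_0_iff)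
    moreover have "d m * 1 \<le> d m * (2 * (W m \<bullet> w))"
      using m(1) d_pos[of m] by (intro mult_left_mono) auto
    ultimately show False using t(2) by simp
  qed
  then obtain \<gamma> where "\<gamma> > 0"
    "\<And>x. x \<in> supported J \<Longrightarrow> norm x \<le> R \<Longrightarrow> \<exists>u\<in>S. \<gamma> * (norm (x - u))\<^sup>2 \<le> E x" by blast
  then show thesis
    by (intro that[of \<gamma>]) (auto simp: S_def E_def)
qed

end

section \<open>The weighted l1 norm and its proximity operator\<close>

lemma support_fun_Icc:
  assumes "a \<le> b" shows "support_fun {a..b} t = ereal (max (a * t) (b * t))"
  unfolding support_fun_def
proof (rule antisym)
  show "(SUP s\<in>{a..b}. ereal (s * t)) \<le> ereal (max (a * t) (b * t))"
  proof (rule SUP_least)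
    fix s assume s: "s \<in> {a..b}"
    have "s * t \<le> max (a * t) (b * t)"
    proof (cases "0 \<le> t")
      case True
      then have "s * t \<le> b * t" using s by (intro mult_right_mono) auto
      then show ?thesis by simp
    next
      case False
      then have "s * t \<le> a * t" using s by (intro mult_right_mono_neg) auto
      then show ?thesis by simp
    qed
    then show "ereal (s * t) \<le> ereal (max (a * t) (b * t))" by (simp only: ereal_less_eq)
  qed
  have "ereal (a * t) \<le> (SUP s\<in>{a..b}. ereal (s * t))"
    "ereal (b * t) \<le> (SUP s\<in>{a..b}. ereal (s * t))"
    using assms by (auto intro: SUP_upper)
  then show "ereal (max (a * t) (b * t)) \<le> (SUP s\<in>{a..b}. ereal (s * t))"
    by (auto simp: max_def)
qed

locale weighted_l1 = hilbert_basis N e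
  for N :: "nat set" and e :: "nat \<Rightarrow> 'a :: real_inner" +
  fixes a b :: "nat \<Rightarrow> real" and \<omega> :: real
  assumes \<omega>_pos: "0 < \<omega>"
    and a_le: "k \<in> N \<Longrightarrow> a k \<le> - \<omega>" and b_ge: "k \<in> N \<Longrightarrow> \<omega> \<le> b k"
begin

definition \<sigma> :: "nat \<Rightarrow> real \<Rightarrow> real" where "\<sigma> k t = max (a k * t) (b k * t)"

abbreviation G :: "'a \<Rightarrow> ereal" where "G \<equiv> norm_1I N e (\<lambda>k. {a k..b k})"

text \<open>
  The value of \<open>G\<close> as a real number, for vectors supported in the finite set \<open>F\<close>.
\<close>

definition G_on :: "nat set \<Rightarrow> 'a \<Rightarrow> real" where "G_on F u = (\<Sum>k\<in>F. \<sigma> k (u \<bullet> e k))"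

text \<open>
  \<open>\<xi>\<close> belongs to the subdifferential of \<open>G\<close> at \<open>p\<close>, read off coordinatewise: the subdifferential of
  the support function of \<open>[a, b]\<close> at \<open>t\<close> consists of the \<open>s \<in> [a, b]\<close> with \<open>s t = \<sigma>(t)\<close>. In this
  form it is preserved by limits in each coordinate.
\<close>

definition subgradient :: "'a \<Rightarrow> 'a \<Rightarrow> bool" where
  "subgradient \<xi> p \<longleftrightarrow>
    (\<forall>k\<in>N. a k \<le> \<xi> \<bullet> e k \<and> \<xi> \<bullet> e k \<le> b k \<and> (\<xi> \<bullet> e k) * (p \<bullet> e k) = \<sigma> k (p \<bullet> e k))"

lemma \<sigma>_upper:
  assumes "a k \<le> s" "s \<le> b k" shows "s * t \<le> \<sigma> k t"
proof (cases "0 \<le> t")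
  case True
  then have "s * t \<le> b k * t" using assms by (intro mult_right_mono) auto
  then show ?thesis by (simp add: \<sigma>_def)
next
  case False
  then have "s * t \<le> a k * t" using assms by (intro mult_right_mono_neg) auto
  then show ?thesis by (simp add: \<sigma>_def)
qed

lemma \<sigma>_lower:
  assumes "k \<in> N" shows "\<omega> * \<bar>t\<bar> \<le> \<sigma> k t"
  using \<sigma>_upper[of k \<omega> t] \<sigma>_upper[of k "- \<omega>" t] a_le[OF assms] b_ge[OF assms] \<omega>_pos
  by (cases "0 \<le> t") auto

lemma \<sigma>_nonneg: "k \<in> N \<Longrightarrow> 0 \<le> \<sigma> k t"
  using \<sigma>_lower[of k t] \<omega>_pos by (meson abs_ge_zero less_imp_le mult_nonneg_nonneg order_trans)

lemma \<sigma>_zero [simp]: "\<sigma> k 0 = 0" by (simp add: \<sigma>_def)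

lemma G_eq_infsum: "G u = (\<Sum>\<^sub>\<infinity>k\<in>N. ereal (\<sigma> k (u \<bullet> e k)))"
  unfolding norm_1I_def
proof (rule infsum_cong)
  fix k assume "k \<in> N"
  then have "a k \<le> b k" using a_le b_ge \<omega>_pos by fastforce
  then show "support_fun {a k..b k} (u \<bullet> e k) = ereal (\<sigma> k (u \<bullet> e k))"
    by (simp add: support_fun_Icc \<sigma>_def)
qed

lemma G_on_le_G:
  assumes "finite F" "F \<subseteq> N" shows "ereal (G_on F u) \<le> G u"
proof -
  have "ereal (G_on F u) = (\<Sum>k\<in>F. ereal (\<sigma> k (u \<bullet> e k)))" by (simp add: G_on_def)
  also have "\<dots> \<le> (SUP F\<in>{F. finite F \<and> F \<subseteq> N}. \<Sum>k\<in>F. ereal (\<sigma> k (u \<bullet> e k)))"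
    using assms by (intro SUP_upper) auto
  also have "\<dots> = G u"
    unfolding G_eq_infsum by (rule nonneg_infsum_complete[symmetric]) (simp add: \<sigma>_nonneg)
  finally show ?thesis .
qed

lemma G_nonneg: "0 \<le> G u" using G_on_le_G[of "{}" u] by (simp add: G_on_def zero_ereal_def)

lemma G_supported:
  assumes "finite F" "F \<subseteq> N" "u \<in> supported F" shows "G u = ereal (G_on F u)"
proof -
  have "G u = (\<Sum>\<^sub>\<infinity>k\<in>F. ereal (\<sigma> k (u \<bullet> e k)))"
    unfolding G_eq_infsum by (rule infsum_cong_neutral) (use assms in \<open>auto simp: supported_def\<close>)
  then show ?thesis using assms(1) by (simp add: G_on_def)
qed

lemma norm_le_G_on:
  assumes "finite F" "F \<subseteq> N" "u \<in> supported F" shows "\<omega> * norm u \<le> G_on F u"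
proof -
  have "norm u = norm (\<Sum>k\<in>F. (u \<bullet> e k) *\<^sub>R e k)" using supported_expansion[OF assms] by simp
  also have "\<dots> \<le> (\<Sum>k\<in>F. \<bar>u \<bullet> e k\<bar>)"
    by (rule sum_norm_le) (use assms in \<open>auto simp: norm_basis\<close>)
  finally have "\<omega> * norm u \<le> \<omega> * (\<Sum>k\<in>F. \<bar>u \<bullet> e k\<bar>)" using \<omega>_pos by simp
  also have "\<dots> \<le> G_on F u"
    unfolding sum_distrib_left G_on_def by (intro sum_mono \<sigma>_lower) (use assms in auto)
  finally show ?thesis .
qed

text \<open>
  The inequality holds term by term; the partial sums of \<open>\<Sum>k. (\<xi> \<bullet> e k) ((u - p) \<bullet> e k)\<close> converge
  to \<open>\<xi> \<bullet> (u - p)\<close> by the basis expansion of \<open>u - p\<close>.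
\<close>

lemma subgradient_inequality:
  assumes F: "finite F" "F \<subseteq> N" "p \<in> supported F" and \<xi>: "subgradient \<xi> p"
  shows "ereal (G_on F p + \<xi> \<bullet> (u - p)) \<le> G u"
proof (rule tendsto_upperbound)
  let ?s = "\<lambda>H. \<Sum>k\<in>H. (\<xi> \<bullet> e k) * ((u - p) \<bullet> e k)"
  have "((\<lambda>k. \<xi> \<bullet> (((u - p) \<bullet> e k) *\<^sub>R e k)) has_sum \<xi> \<bullet> (u - p)) N"
    using has_sum_bounded_linear[OF bounded_linear_inner_right has_sum_expansion]
    by (simp add: o_def)
  then have "(?s \<longlongrightarrow> \<xi> \<bullet> (u - p)) (finite_subsets_at_top N)"
    by (simp add: has_sum_def mult.commute)
  then show "((\<lambda>H. ereal (G_on F p + ?s H)) \<longlongrightarrow> ereal (G_on F p + \<xi> \<bullet> (u - p)))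
      (finite_subsets_at_top N)"
    by (intro tendsto_ereal tendsto_add tendsto_const)
  have "ereal (G_on F p + ?s H) \<le> G u" if H: "finite H" "F \<subseteq> H" "H \<subseteq> N" for H
  proof -
    have "G_on F p = G_on H p"
      unfolding G_on_def using F H by (intro sum.mono_neutral_left) (auto simp: supported_def)
    then have "G_on F p + ?s H = (\<Sum>k\<in>H. \<sigma> k (p \<bullet> e k) + (\<xi> \<bullet> e k) * ((u - p) \<bullet> e k))"
      by (simp add: G_on_def sum.distrib)
    also have "\<dots> \<le> G_on H u"
      unfolding G_on_def
    proof (rule sum_mono)
      fix k assume "k \<in> H"
      then have k: "a k \<le> \<xi> \<bullet> e k" "\<xi> \<bullet> e k \<le> b k" "\<sigma> k (p \<bullet> e k) = (\<xi> \<bullet> e k) * (p \<bullet> e k)"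
        using \<xi> H by (auto simp: subgradient_def)
      show "\<sigma> k (p \<bullet> e k) + (\<xi> \<bullet> e k) * ((u - p) \<bullet> e k) \<le> \<sigma> k (u \<bullet> e k)"
        using \<sigma>_upper[OF k(1,2), of "u \<bullet> e k"] by (simp add: k(3) inner_diff_left algebra_simps)
    qed
    finally have "ereal (G_on F p + ?s H) \<le> ereal (G_on H u)" by simp
    also have "\<dots> \<le> G u" by (rule G_on_le_G) (use H in auto)
    finally show ?thesis .
  qed
  then show "\<forall>\<^sub>F H in finite_subsets_at_top N. ereal (G_on F p + ?s H) \<le> G u"
    unfolding eventually_finite_subsets_at_top using F by blast
qed simp

text \<open>
  Adding the quadratic term to the subgradient inequality leaves the surplus
  \<open>\<parallel>u - p\<parallel>\<^sup>2 / (2 lam)\<close>, which yields both minimality and uniqueness.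
\<close>

lemma prox_eqI:
  assumes F: "finite F" "F \<subseteq> N" "p \<in> supported F" and "0 < lam"
    and sub: "subgradient ((1 / lam) *\<^sub>R (z - p)) p"
  shows "prox lam G z = p"
proof -
  let ?Q = "\<lambda>u. G u + ereal (1 / (2 * lam) * (norm (u - z))\<^sup>2)"
  have Gp: "G p = ereal (G_on F p)" by (rule G_supported[OF F])
  have strong: "?Q p + ereal (1 / (2 * lam) * (norm (u - p))\<^sup>2) \<le> ?Q u" for u
  proof -
    have "(norm (u - z))\<^sup>2 = (norm (p - z))\<^sup>2 + (norm (u - p))\<^sup>2 - 2 * ((z - p) \<bullet> (u - p))"
      unfolding power2_norm_eq_inner by (simp add: inner_simps inner_commute algebra_simps)
    then have "1 / (2 * lam) * (norm (p - z))\<^sup>2 + 1 / (2 * lam) * (norm (u - p))\<^sup>2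
        = ((1 / lam) *\<^sub>R (z - p)) \<bullet> (u - p) + 1 / (2 * lam) * (norm (u - z))\<^sup>2"
      using \<open>0 < lam\<close> by (simp only: inner_scaleR_left) (simp add: field_simps)
    then have "?Q p + ereal (1 / (2 * lam) * (norm (u - p))\<^sup>2)
        = ereal (G_on F p + ((1 / lam) *\<^sub>R (z - p)) \<bullet> (u - p))
          + ereal (1 / (2 * lam) * (norm (u - z))\<^sup>2)"
      by (simp add: Gp)
    also have "\<dots> \<le> ?Q u" by (intro add_right_mono subgradient_inequality[OF F sub])
    finally show ?thesis .
  qed
  have min: "is_arg_min ?Q (\<lambda>_. True) p"
    unfolding is_arg_min_linorder
  proof (intro conjI allI impI TrueI)
    fix u
    have "?Q p + 0 \<le> ?Q p + ereal (1 / (2 * lam) * (norm (u - p))\<^sup>2)"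
      using \<open>0 < lam\<close> by (intro add_left_mono) simp
    then show "?Q p \<le> ?Q u" using strong[of u] by (simp del: plus_ereal.simps)
  qed
  have "u = p" if "is_arg_min ?Q (\<lambda>_. True) u" for u
  proof -
    have "?Q u \<le> ?Q p" using that by (simp add: is_arg_min_linorder)
    then have "?Q p + ereal (1 / (2 * lam) * (norm (u - p))\<^sup>2) \<le> ?Q p"
      using strong[of u] order_trans by blast
    then have "1 / (2 * lam) * (norm (u - p))\<^sup>2 \<le> 0" by (simp add: Gp)
    then have "(norm (u - p))\<^sup>2 \<le> 0" using \<open>0 < lam\<close> by (simp add: field_simps)
    then show ?thesis by simp
  qed
  then show ?thesis unfolding prox_def using min by (rule the_equality[rotated])
qed

text \<open>
  If \<open>p \<bullet> e k\<close> were nonzero, then \<open>z \<bullet> e k\<close> would have its sign and exceed it in modulus by at least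
  \<open>lam \<omega>\<close>, because \<open>\<sigma> k t \<ge> \<omega> \<bar>t\<bar>\<close>.
\<close>

lemma subgradient_thresholds:
  assumes k: "k \<in> N" and "0 < lam" and sub: "subgradient ((1 / lam) *\<^sub>R (z - p)) p"
    and small: "\<bar>z \<bullet> e k\<bar> \<le> lam * \<omega>"
  shows "p \<bullet> e k = 0"
proof (rule ccontr)
  assume nz: "p \<bullet> e k \<noteq> 0"
  define s where "s = ((1 / lam) *\<^sub>R (z - p)) \<bullet> e k"
  have z: "z \<bullet> e k = lam * s + p \<bullet> e k"
    using \<open>0 < lam\<close> by (simp add: s_def inner_diff_left)
  have "s * (p \<bullet> e k) = \<sigma> k (p \<bullet> e k)" using sub k unfolding subgradient_def s_def by blast
  then have "\<omega> * \<bar>p \<bullet> e k\<bar> \<le> s * (p \<bullet> e k)" using \<sigma>_lower[OF k] by simp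
  then have "\<omega> * \<bar>p \<bullet> e k\<bar> \<le> (s * sgn (p \<bullet> e k)) * \<bar>p \<bullet> e k\<bar>"
    by (simp add: mult.assoc sgn_mult_abs)
  then have "\<omega> \<le> s * sgn (p \<bullet> e k)" using nz by (simp only: mult_le_cancel_right)
  then have "lam * \<omega> \<le> lam * (s * sgn (p \<bullet> e k))" using \<open>0 < lam\<close> by simp
  then show False using nz small z by (cases "0 < p \<bullet> e k") (auto simp: abs_le_iff)
qed

text \<open>
  The proximal point is found explicitly: by Moreau's decomposition, its \<open>k\<close>-th coordinate is
  \<open>z \<bullet> e k\<close> minus \<open>lam\<close> times the projection \<open>c k\<close> of \<open>z \<bullet> e k / lam\<close> onto \<open>[a k, b k]\<close>. It
  vanishes unless \<open>\<bar>z \<bullet> e k\<bar> \<ge> lam \<omega>\<close>, so a finite sum defines it.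
\<close>

lemma prox_subgradient:
  assumes "0 < lam"
  obtains F where "finite F" "F \<subseteq> N" "prox lam G z \<in> supported F"
    "subgradient ((1 / lam) *\<^sub>R (z - prox lam G z)) (prox lam G z)"
proof -
  define F where "F = {k \<in> N. lam * \<omega> \<le> \<bar>z \<bullet> e k\<bar>}"
  have F: "finite F" "F \<subseteq> N"
    unfolding F_def using finite_large_coords[of "lam * \<omega>" z] assms \<omega>_pos by auto
  define c where "c k = max (a k) (min (b k) (z \<bullet> e k / lam))" for k
  define p where "p = (\<Sum>k\<in>F. (z \<bullet> e k - lam * c k) *\<^sub>R e k)"
  have p: "p \<bullet> e k = z \<bullet> e k - lam * c k" if "k \<in> N" for k
  proof (cases "k \<in> F")
    case False
    then have "\<bar>z \<bullet> e k\<bar> < lam * \<omega>" using that by (simp add: F_def)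
    then have "- \<omega> < z \<bullet> e k / lam" "z \<bullet> e k / lam < \<omega>"
      using assms by (auto simp: field_simps abs_less_iff)
    then have "c k = z \<bullet> e k / lam" using a_le[OF that] b_ge[OF that] by (simp add: c_def)
    then show ?thesis using False that F assms by (simp add: p_def inner_sum_basis)
  qed (use that F in \<open>simp add: p_def inner_sum_basis\<close>)
  have supp: "p \<in> supported F"
    unfolding supported_def p_def using F by (simp add: inner_sum_basis)
  have sub: "subgradient ((1 / lam) *\<^sub>R (z - p)) p"
    unfolding subgradient_def
  proof
    fix k assume k: "k \<in> N"
    have ab: "a k \<le> b k" using a_le[OF k] b_ge[OF k] \<omega>_pos by simp
    have \<xi>: "((1 / lam) *\<^sub>R (z - p)) \<bullet> e k = c k" using assms by (simp add: inner_diff_left p[OF k])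
    have c: "a k \<le> c k" "c k \<le> b k" using ab by (auto simp: c_def)
    have "\<sigma> k (p \<bullet> e k) \<le> c k * (p \<bullet> e k)"
    proof -
      consider "c k = z \<bullet> e k / lam" | "c k = b k" "b k \<le> z \<bullet> e k / lam"
        | "c k = a k" "z \<bullet> e k / lam \<le> a k"
        using ab unfolding c_def by linarith
      then show ?thesis
      proof cases
        case 1
        then have "p \<bullet> e k = 0" using assms by (simp add: p[OF k])
        then show ?thesis by simp
      next
        case 2
        then have "0 \<le> p \<bullet> e k" using assms by (simp add: p[OF k] field_simps)
        then show ?thesis using 2 ab by (simp add: \<sigma>_def mult_right_mono)
      next
        case 3
        then have "p \<bullet> e k \<le> 0" using assms by (simp add: p[OF k] field_simps)
        then show ?thesis using 3 ab by (simp add: \<sigma>_def mult_right_mono_neg)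
      qed
    qed
    then show "a k \<le> ((1 / lam) *\<^sub>R (z - p)) \<bullet> e k \<and> ((1 / lam) *\<^sub>R (z - p)) \<bullet> e k \<le> b k \<and>
        ((1 / lam) *\<^sub>R (z - p)) \<bullet> e k * (p \<bullet> e k) = \<sigma> k (p \<bullet> e k)"
      unfolding \<xi> using c \<sigma>_upper[OF c, of "p \<bullet> e k"] by simp
  qed
  have "prox lam G z = p" by (rule prox_eqI[OF F supp assms sub])
  with F supp sub show thesis using that by blast
qed

end

section \<open>Forward-backward iterates\<close>

lemma geometric_steps_converge:
  fixes X :: "nat \<Rightarrow> 'a :: {real_normed_vector, complete_space}"
  assumes step: "\<And>n. norm (X (Suc n) - X n) \<le> C * s ^ n" and s: "0 \<le> s" "s < 1"
  obtains l where "X \<longlonglongrightarrow> l" "\<And>n. norm (X n - l) \<le> C / (1 - s) * s ^ n"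
proof -
  have "0 \<le> C" using order_trans[OF norm_ge_zero step[of 0]] by simp
  define B where "B = C / (1 - s)"
  have "0 \<le> B" using \<open>0 \<le> C\<close> s by (simp add: B_def)
  have C: "C = B * (1 - s)" using s by (simp add: B_def)
  have tele: "norm (X (n + m) - X n) \<le> B * s ^ n * (1 - s ^ m)" for n m
  proof (induction m)
    case (Suc m)
    have "norm (X (n + Suc m) - X n) \<le> norm (X (Suc (n + m)) - X (n + m)) + norm (X (n + m) - X n)"
      using norm_triangle_ineq[of "X (Suc (n + m)) - X (n + m)" "X (n + m) - X n"] by simp
    also have "\<dots> \<le> C * s ^ (n + m) + B * s ^ n * (1 - s ^ m)" using step Suc by (rule add_mono)
    also have "\<dots> = B * s ^ n * (1 - s ^ Suc m)" by (simp add: C power_add algebra_simps)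
    finally show ?case .
  qed simp
  have tail: "norm (X m - X n) \<le> B * s ^ n" if "n \<le> m" for m n
  proof -
    have "norm (X m - X n) \<le> B * s ^ n * (1 - s ^ (m - n))" using tele[of n "m - n"] that by simp
    also have "\<dots> \<le> B * s ^ n * 1" using \<open>0 \<le> B\<close> s by (intro mult_left_mono) auto
    finally show ?thesis by simp
  qed
  have to_zero: "(\<lambda>n. B * s ^ n) \<longlonglongrightarrow> 0"
    using tendsto_mult_right_zero[OF LIMSEQ_realpow_zero[OF s]] .
  have "Cauchy X"
  proof (rule CauchyI)
    fix d :: real assume "0 < d"
    then have "\<forall>\<^sub>F n in sequentially. B * s ^ n < d" using to_zero by (intro order_tendstoD)
    then obtain M where M: "\<And>n. M \<le> n \<Longrightarrow> B * s ^ n < d"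
      unfolding eventually_sequentially by blast
    have "norm (X m - X n) < d" if "M \<le> m" "M \<le> n" for m n
    proof (cases "m \<le> n")
      case True
      then show ?thesis using tail[of m n] M[OF that(1)] by (simp add: norm_minus_commute)
    next
      case False
      then show ?thesis using tail[of n m] M[OF that(2)] by simp
    qed
    then show "\<exists>M. \<forall>m\<ge>M. \<forall>n\<ge>M. norm (X m - X n) < d" by blast
  qed
  then obtain l where l: "X \<longlonglongrightarrow> l" using Cauchy_convergent convergentD by blast
  have "norm (X n - l) \<le> B * s ^ n" for n
  proof (rule tendsto_upperbound)
    show "(\<lambda>m. norm (X n - X m)) \<longlonglongrightarrow> norm (X n - l)" by (intro tendsto_intros l)
    show "\<forall>\<^sub>F m in sequentially. norm (X n - X m) \<le> B * s ^ n"
      using tail[of n] by (auto simp: eventually_sequentially norm_minus_commute)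
  qed simp
  with l show thesis using that unfolding B_def by blast
qed

locale iterative_thresholding = weighted_l1 N e a b \<omega>
  for N and e :: "nat \<Rightarrow> 'a :: {real_inner, polish_space}" and a b \<omega> +
  fixes A :: "'a \<Rightarrow> 'b :: {real_inner, polish_space}" and y :: 'b
    and L lam :: real and x :: "nat \<Rightarrow> 'a"
  assumes A: "bounded_linear A" and L_pos: "0 < L"
    and lipschitz: "L-lipschitz_on UNIV (gradient (least_squares A y))"
    and lam_pos: "0 < lam" and lam_less: "lam < 2 / L"
    and iterate: "x (Suc n) = prox lam G (x n - lam *\<^sub>R gradient (least_squares A y) (x n))"
begin

sublocale A: bounded_linear A by (rule A)

abbreviation h :: "'a \<Rightarrow> real" where "h \<equiv> least_squares A y"

abbreviation D :: "'a \<Rightarrow> 'a" where "D \<equiv> gradient h"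

text \<open>The subgradient of \<open>G\<close> at \<open>x (Suc n)\<close> that the proximal step provides.\<close>

definition \<xi> :: "nat \<Rightarrow> 'a" where "\<xi> n = (1 / lam) *\<^sub>R (x n - lam *\<^sub>R D (x n) - x (Suc n))"

text \<open>
  The objective along the iterates, as a real number. At the starting point \<open>G\<close> may be
  infinite, and then \<open>f 0\<close> has no meaning; the estimates therefore use \<open>f\<close> at positive indices only.
\<close>

definition f :: "nat \<Rightarrow> real" where "f n = real_of_ereal (G (x n)) + h (x n)"

text \<open>The factor in the descent inequality; it is positive exactly because \<open>lam < 2 / L\<close>.\<close>

definition \<kappa> :: real where "\<kappa> = 1 / lam - L / 2"

definition \<delta> :: "nat \<Rightarrow> real" where "\<delta> n = norm (x (Suc n) - x n)"

lemma D_inner: "D u \<bullet> v = (A u - y) \<bullet> A v" by (rule gradient_least_squares_inner[OF A])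

lemma D_lipschitz: "norm (D u - D v) \<le> L * norm (u - v)"
  using lipschitz_onD[OF lipschitz, of u v] by (simp add: dist_norm)

text \<open>The Lipschitz constant of \<open>\<nabla>h = A\<^sup>*(A \<cdot> - y)\<close> bounds \<open>\<parallel>A\<parallel>\<^sup>2\<close>, since \<open>\<parallel>A v\<parallel>\<^sup>2 = (\<nabla>h(v) - \<nabla>h(0)) \<bullet> v\<close>.\<close>

lemma norm_A_le: "(norm (A v))\<^sup>2 \<le> L * (norm v)\<^sup>2"
proof -
  have "(norm (A v))\<^sup>2 = (D v - D 0) \<bullet> v"
    by (simp add: D_inner inner_diff_left A.zero power2_norm_eq_inner)
  also have "\<dots> \<le> norm (D v - D 0) * norm v" by (rule norm_cauchy_schwarz)
  also have "\<dots> \<le> L * norm v * norm v" using D_lipschitz[of v 0] by (intro mult_right_mono) auto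
  finally show ?thesis by (simp add: power2_eq_square)
qed

lemma \<kappa>_pos: "0 < \<kappa>"
  using lam_less lam_pos L_pos unfolding \<kappa>_def by (simp add: field_simps)

lemma h_nonneg: "0 \<le> h u" by (simp add: least_squares_def)

lemma h_expansion: "h u = h p + D p \<bullet> (u - p) + 1 / 2 * (norm (A (u - p)))\<^sup>2"
  unfolding D_inner by (rule least_squares_expansion[OF A])

lemma iterate_support:
  obtains F where "finite F" "F \<subseteq> N" "x (Suc n) \<in> supported F"
  by (rule prox_subgradient[OF lam_pos, of "x n - lam *\<^sub>R D (x n)"]) (simp add: that iterate)

lemma iterate_subgradient: "subgradient (\<xi> n) (x (Suc n))"
  by (rule prox_subgradient[OF lam_pos, of "x n - lam *\<^sub>R D (x n)"])
    (simp add: \<xi>_def iterate)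

lemma G_iterate: "G (x (Suc n)) = ereal (f (Suc n) - h (x (Suc n)))"
proof -
  obtain F where "finite F" "F \<subseteq> N" "x (Suc n) \<in> supported F" by (rule iterate_support)
  from G_supported[OF this] show ?thesis by (simp add: f_def)
qed

lemma iterate_subgradient_inequality:
  assumes "G u = ereal g"
  shows "f (Suc n) - h (x (Suc n)) + \<xi> n \<bullet> (u - x (Suc n)) \<le> g"
proof -
  obtain F where F: "finite F" "F \<subseteq> N" "x (Suc n) \<in> supported F" by (rule iterate_support)
  then have "ereal (G_on F (x (Suc n)) + \<xi> n \<bullet> (u - x (Suc n))) \<le> G u"
    by (rule subgradient_inequality) (rule iterate_subgradient)
  then show ?thesis using G_supported[OF F] assms by (simp add: G_iterate)
qed

text \<open>
  \<open>\<xi> n + \<nabla>h(x\<^sup>n\<^sup>+\<^sup>1)\<close> is a subgradient of the objective at the new iterate, of norm at most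
  \<open>(1 / lam + L) \<delta> n\<close>. Keeping the quadratic remainder of \<open>h\<close> on the left is what makes the
  images \<open>A x\<^sup>n\<close> converge.
\<close>

lemma step_inequality:
  assumes "G u = ereal g"
  shows "f (Suc n) + 1 / 2 * (norm (A (x (Suc n) - u)))\<^sup>2
    \<le> g + h u + (1 / lam + L) * \<delta> n * norm (x (Suc n) - u)"
proof -
  define p where "p = x (Suc n)"
  have \<xi>: "\<xi> n = - (1 / lam) *\<^sub>R (p - x n) - D (x n)"
    using lam_pos by (simp add: \<xi>_def p_def algebra_simps)
  have hu: "h u = h p + D p \<bullet> (u - p) + 1 / 2 * (norm (A (p - u)))\<^sup>2"
    using h_expansion[of u p] by (simp add: A.diff norm_minus_commute)
  have "f (Suc n) + 1 / 2 * (norm (A (p - u)))\<^sup>2 - (g + h u) \<le> - ((\<xi> n + D p) \<bullet> (u - p))"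
    using iterate_subgradient_inequality[OF assms, of n] unfolding hu p_def[symmetric]
    by (simp add: inner_add_left)
  also have "\<dots> \<le> norm (\<xi> n + D p) * norm (u - p)"
    using Cauchy_Schwarz_ineq2[of "\<xi> n + D p" "u - p"] by linarith
  also have "\<dots> \<le> ((1 / lam + L) * \<delta> n) * norm (u - p)"
  proof (rule mult_right_mono)
    have "norm (\<xi> n + D p) = norm ((D p - D (x n)) - (1 / lam) *\<^sub>R (p - x n))"
      by (simp add: \<xi> algebra_simps)
    also have "\<dots> \<le> norm (D p - D (x n)) + norm ((1 / lam) *\<^sub>R (p - x n))"
      by (rule norm_triangle_ineq4)
    also have "\<dots> \<le> L * norm (p - x n) + 1 / lam * norm (p - x n)"
      using D_lipschitz[of p "x n"] lam_pos by simp
    finally show "norm (\<xi> n + D p) \<le> (1 / lam + L) * \<delta> n"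
      by (simp add: \<delta>_def p_def algebra_simps)
  qed simp
  finally show ?thesis unfolding p_def by (simp add: norm_minus_commute)
qed

lemma descent:
  assumes "G (x n) = ereal g"
  shows "f (Suc n) + \<kappa> * (\<delta> n)\<^sup>2 \<le> g + h (x n)"
proof -
  define p where "p = x (Suc n)"
  have "\<xi> n \<bullet> (x n - p) = (1 / lam) * (\<delta> n)\<^sup>2 + D (x n) \<bullet> (p - x n)"
    unfolding \<delta>_def \<xi>_def p_def power2_norm_eq_inner using lam_pos
    by (simp add: inner_simps inner_commute field_simps)
  moreover have "f (Suc n) - h p + \<xi> n \<bullet> (x n - p) \<le> g"
    using iterate_subgradient_inequality[OF assms, of n] unfolding p_def .
  moreover have "h p = h (x n) + D (x n) \<bullet> (p - x n) + 1 / 2 * (norm (A (p - x n)))\<^sup>2"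
    by (rule h_expansion)
  moreover have "(norm (A (p - x n)))\<^sup>2 \<le> L * (\<delta> n)\<^sup>2" unfolding \<delta>_def p_def by (rule norm_A_le)
  ultimately show ?thesis by (simp add: \<kappa>_def algebra_simps)
qed

lemma descent_Suc: "f (Suc (Suc n)) + \<kappa> * (\<delta> (Suc n))\<^sup>2 \<le> f (Suc n)"
  using descent[OF G_iterate] by simp

lemma norm_iterate_le: "\<omega> * norm (x (Suc n)) \<le> f (Suc n)"
proof -
  obtain F where F: "finite F" "F \<subseteq> N" "x (Suc n) \<in> supported F" by (rule iterate_support)
  then have "\<omega> * norm (x (Suc n)) \<le> G_on F (x (Suc n))" by (rule norm_le_G_on)
  also have "\<dots> = f (Suc n) - h (x (Suc n))" using G_supported[OF F] by (simp add: G_iterate)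
  finally show ?thesis using h_nonneg[of "x (Suc n)"] by simp
qed

lemma f_decreasing: "decseq (\<lambda>n. f (Suc n))"
proof (rule decseq_SucI)
  fix n
  have "0 \<le> \<kappa> * (\<delta> (Suc n))\<^sup>2" using \<kappa>_pos by simp
  then show "f (Suc (Suc n)) \<le> f (Suc n)" using descent_Suc[of n] by linarith
qed

text \<open>
  All iterates from \<open>x 1\<close> on lie in the ball of radius \<open>R\<close>, since the objective dominates \<open>\<omega>\<close> times the norm and
  decreases.
\<close>

definition R :: real where "R = f (Suc 0) / \<omega>"

lemma norm_iterate: "norm (x (Suc n)) \<le> R"
  using norm_iterate_le[of n] decseqD[OF f_decreasing, of 0 n] \<omega>_pos
  by (simp add: R_def field_simps)

lemma steps_to_zero: "\<delta> \<longlonglongrightarrow> 0"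
proof -
  have nonneg: "0 \<le> f (Suc n)" for n
    using norm_iterate_le[of n] \<omega>_pos by (meson mult_nonneg_nonneg norm_ge_zero less_imp_le order_trans)
  obtain c where c: "(\<lambda>n. f (Suc n)) \<longlonglongrightarrow> c"
    using decseq_convergent[OF f_decreasing, of 0] nonneg by blast
  have "(\<lambda>n. sqrt ((f (Suc n) - f (Suc (Suc n))) / \<kappa>)) \<longlonglongrightarrow> sqrt ((c - c) / \<kappa>)"
    using \<kappa>_pos by (intro tendsto_intros c LIMSEQ_Suc[OF c]) simp
  then have lim: "(\<lambda>n. sqrt ((f (Suc n) - f (Suc (Suc n))) / \<kappa>)) \<longlonglongrightarrow> 0" by simp
  have "\<delta> (Suc n) \<le> sqrt ((f (Suc n) - f (Suc (Suc n))) / \<kappa>)" for n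
    using descent_Suc[of n] \<kappa>_pos by (intro real_le_rsqrt) (simp add: field_simps)
  then have "(\<lambda>n. \<delta> (Suc n)) \<longlonglongrightarrow> 0"
    by (intro tendsto_sandwich[OF _ _ tendsto_const lim]) (auto simp: \<delta>_def)
  then show ?thesis by (rule LIMSEQ_imp_Suc)
qed

text \<open>
  Adding \<open>step_inequality\<close> at index \<open>n\<close> against the iterate with index \<open>m + 1\<close> to the same inequality with
  \<open>m\<close> and \<open>n\<close> exchanged cancels the objective values and leaves
  \<open>\<parallel>A (x\<^sup>n\<^sup>+\<^sup>1 - x\<^sup>m\<^sup>+\<^sup>1)\<parallel>\<^sup>2 \<le> K (\<delta> n + \<delta> m)\<close>.
\<close>

lemma images_converge: "\<exists>c. (\<lambda>n. A (x n)) \<longlonglongrightarrow> c"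
proof -
  define K where "K = (1 / lam + L) * (2 * R)"
  have "0 \<le> R" using order_trans[OF norm_ge_zero norm_iterate] .
  then have "0 \<le> K" using lam_pos L_pos by (simp add: K_def)
  have half: "f (Suc n) + 1 / 2 * (norm (A (x (Suc n)) - A (x (Suc m))))\<^sup>2 \<le> f (Suc m) + K * \<delta> n"
    for m n
  proof -
    have "norm (x (Suc n) - x (Suc m)) \<le> 2 * R"
      using norm_triangle_ineq4[of "x (Suc n)" "x (Suc m)"] norm_iterate[of n] norm_iterate[of m]
      by simp
    then have "(1 / lam + L) * \<delta> n * norm (x (Suc n) - x (Suc m)) \<le> (1 / lam + L) * \<delta> n * (2 * R)"
      using lam_pos L_pos by (intro mult_left_mono) (auto simp: \<delta>_def)
    then show ?thesis
      using step_inequality[OF G_iterate, of n m] by (simp add: K_def A.diff algebra_simps)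
  qed
  have close: "(norm (A (x (Suc n)) - A (x (Suc m))))\<^sup>2 \<le> K * \<delta> n + K * \<delta> m" for m n
    using half[of n m] half[of m n] by (simp add: norm_minus_commute)
  have "Cauchy (\<lambda>n. A (x (Suc n)))"
  proof (rule CauchyI)
    fix d :: real assume "0 < d"
    have "(\<lambda>n. K * \<delta> n) \<longlonglongrightarrow> 0" by (rule tendsto_mult_right_zero[OF steps_to_zero])
    then have "\<forall>\<^sub>F n in sequentially. K * \<delta> n < d\<^sup>2 / 2"
      by (rule order_tendstoD) (use \<open>0 < d\<close> in simp)
    then obtain M where M: "\<And>n. M \<le> n \<Longrightarrow> K * \<delta> n < d\<^sup>2 / 2"
      unfolding eventually_sequentially by blast
    have "norm (A (x (Suc m)) - A (x (Suc n))) < d" if "M \<le> m" "M \<le> n" for m n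
    proof (rule power2_less_imp_less)
      show "(norm (A (x (Suc m)) - A (x (Suc n))))\<^sup>2 < d\<^sup>2"
        using close[of m n] M[OF that(1)] M[OF that(2)] by linarith
    qed (use \<open>0 < d\<close> in simp)
    then show "\<exists>M. \<forall>m\<ge>M. \<forall>n\<ge>M. norm (A (x (Suc m)) - A (x (Suc n))) < d" by blast
  qed
  then obtain c where "(\<lambda>n. A (x (Suc n))) \<longlonglongrightarrow> c" using Cauchy_convergent convergentD by blast
  then have "(\<lambda>n. A (x n)) \<longlonglongrightarrow> c" by (rule LIMSEQ_imp_Suc)
  then show ?thesis ..
qed

text \<open>
  The vector \<open>q\<close> is the limit of the gradients. Outside the finite set of coordinates with \<open>\<bar>q \<bullet> e k\<bar> \<ge> \<omega> / 2\<close> the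
  gradients at late iterates have coordinates below \<open>\<omega>\<close>, uniformly in \<open>k\<close>, so a zero coordinate
  stays zero. The iterate from which this holds has finite support itself, and finitely many
  earlier ones are added to the index set.
\<close>

lemma support_identification:
  assumes c: "(\<lambda>n. A (x n)) \<longlonglongrightarrow> c" and q: "\<And>v. q \<bullet> v = (c - y) \<bullet> A v"
  obtains J where "finite J" "J \<subseteq> N" "\<And>n. x (Suc n) \<in> supported J"
proof -
  obtain F where F: "\<And>n. finite (F n)" "\<And>n. F n \<subseteq> N" "\<And>n. x (Suc n) \<in> supported (F n)"
  proof -
    have "\<exists>F. finite F \<and> F \<subseteq> N \<and> x (Suc n) \<in> supported F" for n
      by (rule iterate_support[of n]) blast
    then show thesis using that by metis
  qed
  obtain K where K: "0 < K" "\<And>v. norm (A v) \<le> norm v * K" using A.pos_bounded by blast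
  have "(\<lambda>n. norm (A (x n) - c) * K) \<longlonglongrightarrow> norm (c - c) * K" by (intro tendsto_intros c)
  then have "\<forall>\<^sub>F n in sequentially. norm (A (x n) - c) * K < \<omega> / 2"
    by (rule order_tendstoD) (use \<omega>_pos in simp)
  then obtain M where M: "\<And>n. M \<le> n \<Longrightarrow> norm (A (x n) - c) * K < \<omega> / 2"
    unfolding eventually_sequentially by blast
  define J0 where "J0 = {k \<in> N. \<omega> / 2 \<le> \<bar>q \<bullet> e k\<bar>}"
  define J where "J = J0 \<union> (\<Union>n\<le>M. F n)"
  have J: "finite J" "J \<subseteq> N"
    using F finite_large_coords[of "\<omega> / 2" q] \<omega>_pos by (auto simp: J_def J0_def)
  have grad_small: "\<bar>D (x n) \<bullet> e k\<bar> \<le> \<omega>" if "M \<le> n" "k \<in> N - J" for n k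
  proof -
    have "D (x n) \<bullet> e k = q \<bullet> e k + (A (x n) - c) \<bullet> A (e k)"
      by (simp add: D_inner q inner_diff_left)
    moreover have "\<bar>(A (x n) - c) \<bullet> A (e k)\<bar> \<le> norm (A (x n) - c) * K"
      using Cauchy_Schwarz_ineq2[of "A (x n) - c" "A (e k)"] K(2)[of "e k"] that
        mult_left_mono[of "norm (A (e k))" K "norm (A (x n) - c)"] by (simp add: norm_basis)
    moreover have "\<bar>q \<bullet> e k\<bar> < \<omega> / 2" using that by (auto simp: J_def J0_def)
    ultimately show ?thesis using M[OF that(1)] by linarith
  qed
  have late: "x (Suc (M + m)) \<in> supported J" for m
  proof (induction m)
    case 0
    show ?case using F(3)[of M] by (auto simp: supported_def J_def)
  next
    case (Suc m)
    define i where "i = Suc (M + m)"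
    have "x (Suc i) \<bullet> e k = 0" if k: "k \<in> N - J" for k
    proof (rule subgradient_thresholds)
      show "subgradient ((1 / lam) *\<^sub>R (x i - lam *\<^sub>R D (x i) - x (Suc i))) (x (Suc i))"
        using iterate_subgradient[of i] unfolding \<xi>_def .
      have "x i \<bullet> e k = 0" using Suc k unfolding i_def supported_def by blast
      then show "\<bar>(x i - lam *\<^sub>R D (x i)) \<bullet> e k\<bar> \<le> lam * \<omega>"
        using grad_small[OF _ k, of i] lam_pos
        by (simp add: inner_diff_left abs_mult i_def)
    qed (use k lam_pos in auto)
    then show ?case by (simp add: supported_def i_def)
  qed
  have "x (Suc n) \<in> supported J" for n
  proof (cases "n \<le> M")
    case True
    then show ?thesis using F(3)[of n] by (auto simp: supported_def J_def)
  next
    case False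
    then show ?thesis using late[of "n - M"] by simp
  qed
  with J show thesis using that by blast
qed

lemma continuous_\<sigma>: "continuous_on UNIV (\<sigma> k)"
  unfolding \<sigma>_def[abs_def] by (intro continuous_intros)

text \<open>
  The steps vanish and the gradients converge to \<open>q\<close>, so \<open>\<xi> n\<close> tends weakly to \<open>-q\<close>; the
  subgradient relation passes to a convergent subsequence of the iterates.
\<close>

lemma cluster_point:
  obtains J z q where "finite J" "J \<subseteq> N" "\<And>n. x (Suc n) \<in> supported J" "z \<in> supported J"
    "subgradient (- q) z" "q = D z"
proof -
  obtain c where c: "(\<lambda>n. A (x n)) \<longlonglongrightarrow> c" using images_converge by blast
  obtain q where q: "\<And>v. q \<bullet> v = (c - y) \<bullet> A v"
    using bounded_linear_functional_eq_inner[OF bounded_linear_inner_comp[OF A]] by blast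
  obtain J where J: "finite J" "J \<subseteq> N" "\<And>n. x (Suc n) \<in> supported J"
    by (rule support_identification[OF c q]) (rule that)
  obtain r z where rz: "strict_mono (r :: nat \<Rightarrow> nat)" "(\<lambda>n. x (Suc (r n))) \<longlonglongrightarrow> z" "z \<in> supported J"
    by (rule supported_bounded_subsequence[OF J norm_iterate])
  have "(\<lambda>n. A (x (Suc (r n)))) \<longlonglongrightarrow> A z" by (rule A.tendsto[OF rz(2)])
  moreover have "(\<lambda>n. A (x (Suc (r n)))) \<longlonglongrightarrow> c"
    using LIMSEQ_subseq_LIMSEQ[OF LIMSEQ_Suc[OF c] rz(1)] by (simp add: o_def)
  ultimately have Az: "A z = c" by (rule LIMSEQ_unique)
  have "(q - D z) \<bullet> (q - D z) = 0" by (simp add: inner_diff_left q D_inner Az)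
  then have qD: "q = D z" by simp
  have \<xi>_lim: "(\<lambda>n. \<xi> n \<bullet> v) \<longlonglongrightarrow> (- q) \<bullet> v" for v
  proof -
    have "(\<lambda>n. x (Suc n) - x n) \<longlonglongrightarrow> 0"
      using steps_to_zero unfolding \<delta>_def by (rule tendsto_norm_zero_cancel)
    then have "(\<lambda>n. - (1 / lam) * ((x (Suc n) - x n) \<bullet> v) - (A (x n) - y) \<bullet> A v)
        \<longlonglongrightarrow> - (1 / lam) * (0 \<bullet> v) - (c - y) \<bullet> A v"
      by (intro tendsto_intros c)
    moreover have "\<xi> n \<bullet> v = - (1 / lam) * ((x (Suc n) - x n) \<bullet> v) - (A (x n) - y) \<bullet> A v" for n
      unfolding \<xi>_def D_inner[symmetric] using lam_pos
      by (simp add: inner_diff_left inner_add_left field_simps)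
    ultimately show ?thesis by (simp add: q)
  qed
  have "subgradient (- q) z"
    unfolding subgradient_def
  proof (intro ballI conjI)
    fix k assume k: "k \<in> N"
    have lim: "(\<lambda>n. \<xi> (r n) \<bullet> e k) \<longlonglongrightarrow> (- q) \<bullet> e k"
      using LIMSEQ_subseq_LIMSEQ[OF \<xi>_lim rz(1)] by (simp add: o_def)
    have sub: "a k \<le> \<xi> n \<bullet> e k" "\<xi> n \<bullet> e k \<le> b k"
      "(\<xi> n \<bullet> e k) * (x (Suc n) \<bullet> e k) = \<sigma> k (x (Suc n) \<bullet> e k)" for n
      using iterate_subgradient[of n] k by (auto simp: subgradient_def)
    show "a k \<le> (- q) \<bullet> e k" by (rule LIMSEQ_le_const[OF lim]) (use sub in auto)
    show "(- q) \<bullet> e k \<le> b k" by (rule LIMSEQ_le_const2[OF lim]) (use sub in auto)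
    have xz: "(\<lambda>n. x (Suc (r n)) \<bullet> e k) \<longlonglongrightarrow> z \<bullet> e k" by (intro tendsto_intros rz)
    have "(\<lambda>n. (\<xi> (r n) \<bullet> e k) * (x (Suc (r n)) \<bullet> e k)) \<longlonglongrightarrow> (- q) \<bullet> e k * (z \<bullet> e k)"
      by (intro tendsto_mult lim xz)
    moreover have "(\<lambda>n. \<sigma> k (x (Suc (r n)) \<bullet> e k)) \<longlonglongrightarrow> \<sigma> k (z \<bullet> e k)"
      by (rule continuous_on_tendsto_compose[OF continuous_\<sigma> xz]) auto
    ultimately show "(- q) \<bullet> e k * (z \<bullet> e k) = \<sigma> k (z \<bullet> e k)"
      unfolding sub(3) by (rule LIMSEQ_unique)
  qed
  with J rz(3) qD show thesis using that by blast
qed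

end

section \<open>Linear convergence\<close>

context iterative_thresholding
begin

text \<open>
  The support function of the interval \<open>[a k, b k]\<close> shifted by \<open>q \<bullet> e k\<close>. It is nonnegative when
  \<open>-q\<close> is a subgradient, since then the shifted interval contains zero.
\<close>

definition \<phi> :: "'a \<Rightarrow> nat \<Rightarrow> real \<Rightarrow> real" where "\<phi> q k t = \<sigma> k t + (q \<bullet> e k) * t"

text \<open>Fermat's rule: by convexity of \<open>h\<close>, a point where \<open>-\<nabla>h\<close> is a subgradient of \<open>G\<close> minimizes \<open>G + h\<close>.\<close>

lemma stationary_minimizes:
  assumes z: "finite J" "J \<subseteq> N" "z \<in> supported J" "subgradient (- D z) z"
  shows "ereal (G_on J z + h z) \<le> G u + ereal (h u)"
proof -
  have "ereal (G_on J z + h z) \<le> ereal (G_on J z + (- D z) \<bullet> (u - z)) + ereal (h u)"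
    using h_expansion[of u z] by simp
  also have "\<dots> \<le> G u + ereal (h u)" by (intro add_right_mono subgradient_inequality z)
  finally show ?thesis .
qed

text \<open>
  The second-order expansion of \<open>h\<close> at \<open>z\<close> is exact, and summing the subgradient
  relation at \<open>z\<close> over the coordinates gives \<open>G z + \<nabla>h(z) \<bullet> z = 0\<close>, so nothing but the \<open>\<phi>\<close>-terms and the quadratic
  remainder survives.
\<close>

lemma excess_formula:
  assumes z: "finite J" "J \<subseteq> N" "z \<in> supported J" "subgradient (- D z) z"
    and u: "u \<in> supported J"
  shows "G_on J u + h u - (G_on J z + h z)
    = (\<Sum>k\<in>J. \<phi> (D z) k (u \<bullet> e k)) + 1 / 2 * (norm (A u - A z))\<^sup>2"
proof -
  have inner_J: "D z \<bullet> v = (\<Sum>k\<in>J. (D z \<bullet> e k) * (v \<bullet> e k))" if "v \<in> supported J" for v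
  proof -
    have "D z \<bullet> v = D z \<bullet> (\<Sum>k\<in>J. (v \<bullet> e k) *\<^sub>R e k)"
      using supported_expansion[OF z(1,2) that] by simp
    then show ?thesis by (simp add: inner_sum_right mult.commute)
  qed
  have "G_on J z + D z \<bullet> z = (\<Sum>k\<in>J. \<sigma> k (z \<bullet> e k) + (D z \<bullet> e k) * (z \<bullet> e k))"
    by (simp add: G_on_def inner_J[OF z(3)] sum.distrib)
  also have "\<dots> = 0"
  proof (intro sum.neutral ballI)
    fix k assume "k \<in> J"
    then have "(- D z \<bullet> e k) * (z \<bullet> e k) = \<sigma> k (z \<bullet> e k)"
      using z(2,4) unfolding subgradient_def by blast
    then show "\<sigma> k (z \<bullet> e k) + (D z \<bullet> e k) * (z \<bullet> e k) = 0" by simp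
  qed
  finally have "G_on J z + D z \<bullet> z = 0" .
  moreover have "G_on J u + D z \<bullet> u = (\<Sum>k\<in>J. \<phi> (D z) k (u \<bullet> e k))"
    by (simp add: G_on_def \<phi>_def inner_J[OF u] sum.distrib)
  ultimately show ?thesis using h_expansion[of u z] by (simp add: inner_diff_right A.diff)
qed

text \<open>
  Let \<open>\<rho>\<close> be the excess at the new iterate \<open>p\<close> and \<open>v\<close> a minimizer given by the growth property. Then
  \<open>\<rho> \<le> M \<delta> n \<parallel>p - v\<parallel>\<close> and \<open>\<gamma> \<parallel>p - v\<parallel>\<^sup>2 \<le> \<rho>\<close> give \<open>\<gamma> \<rho> \<le> (M \<delta> n)\<^sup>2\<close>, and descent gives \<open>\<rho> \<le> K (\<rho>' - \<rho>)\<close>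
  with the previous excess \<open>\<rho>'\<close>, that is \<open>\<rho> \<le> K / (1 + K) \<rho>'\<close>. The value of \<open>G\<close> at \<open>x n\<close> is a
  hypothesis so that the step from \<open>x 0\<close> is covered whenever the objective is finite there.
\<close>

lemma linear_rate:
  obtains J z \<epsilon> where "finite J" "J \<subseteq> N" "\<And>n. x (Suc n) \<in> supported J" "z \<in> supported J"
    "subgradient (- D z) z" "0 < \<epsilon>" "\<epsilon> < 1"
    "\<And>n g. G (x n) = ereal g \<Longrightarrow>
      f (Suc n) - (G_on J z + h z) \<le> \<epsilon> * (g + h (x n) - (G_on J z + h z))"
proof -
  obtain J z q where J: "finite J" "J \<subseteq> N" "\<And>n. x (Suc n) \<in> supported J"
    and z: "z \<in> supported J" "subgradient (- q) z" "q = D z"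
    by (rule cluster_point) (rule that)
  have sub: "subgradient (- D z) z" using z by simp
  define m where "m = G_on J z + h z"
  have s: "a k \<le> - (D z \<bullet> e k)" "- (D z \<bullet> e k) \<le> b k"
    "- (D z \<bullet> e k) * (z \<bullet> e k) = \<sigma> k (z \<bullet> e k)" if "k \<in> J" for k
    using sub that J(2) by (auto simp: subgradient_def)
  have \<phi>_nonneg: "0 \<le> \<phi> (D z) k t" if "k \<in> J" for k t
    using \<sigma>_upper[OF s(1,2)[OF that], of t] by (simp add: \<phi>_def)
  have \<phi>_hom: "\<phi> (D z) k (r * t) = r * \<phi> (D z) k t" if "0 \<le> r" for k r t
    using that by (simp add: \<phi>_def \<sigma>_def max_mult_distrib_left algebra_simps)
  have \<phi>_cont: "continuous_on UNIV (\<phi> (D z) k)" for k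
    unfolding \<phi>_def[abs_def] by (intro continuous_intros continuous_\<sigma>)
  have \<phi>_z: "\<phi> (D z) k (z \<bullet> e k) = 0" if "k \<in> J" for k using s(3)[OF that] by (simp add: \<phi>_def)
  obtain \<gamma> where \<gamma>: "0 < \<gamma>" "\<And>u. u \<in> supported J \<Longrightarrow> norm u \<le> R \<Longrightarrow>
      \<exists>v \<in> supported J. A v = A z \<and> (\<forall>k\<in>J. \<phi> (D z) k (v \<bullet> e k) = 0) \<and>
        \<gamma> * (norm (u - v))\<^sup>2 \<le> (\<Sum>k\<in>J. \<phi> (D z) k (u \<bullet> e k)) + 1 / 2 * (norm (A u - A z))\<^sup>2"
    by (rule quadratic_growth[OF J(1,2) A, of "\<phi> (D z)" z "A z" R])
      (use \<phi>_nonneg \<phi>_hom \<phi>_cont \<phi>_z z(1) that in auto)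
  define M where "M = 1 / lam + L"
  have "0 < M" using lam_pos L_pos by (simp add: M_def add_pos_pos)
  define K where "K = M\<^sup>2 / \<gamma> / \<kappa>"
  have "0 < K" using \<open>0 < M\<close> \<gamma>(1) \<kappa>_pos by (simp add: K_def)
  define \<epsilon> where "\<epsilon> = K / (1 + K)"
  have f_eq: "f (Suc n) = G_on J (x (Suc n)) + h (x (Suc n))" for n
    using G_supported[OF J] by (simp add: f_def)
  have rate: "f (Suc n) - m \<le> \<epsilon> * (g + h (x n) - m)" if g: "G (x n) = ereal g" for n g
  proof -
    define p where "p = x (Suc n)"
    define \<rho> where "\<rho> = f (Suc n) - m"
    have \<rho>: "\<rho> = (\<Sum>k\<in>J. \<phi> (D z) k (p \<bullet> e k)) + 1 / 2 * (norm (A p - A z))\<^sup>2"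
      unfolding \<rho>_def f_eq m_def p_def by (rule excess_formula[OF J(1,2) z(1) sub J(3)])
    obtain v where v: "v \<in> supported J" "A v = A z" "\<And>k. k \<in> J \<Longrightarrow> \<phi> (D z) k (v \<bullet> e k) = 0"
      "\<gamma> * (norm (p - v))\<^sup>2 \<le> \<rho>"
      using \<gamma>(2)[OF J(3) norm_iterate, of n] unfolding p_def[symmetric] \<rho>[symmetric] by blast
    have Gv: "G v = ereal (G_on J v)" by (rule G_supported[OF J(1,2) v(1)])
    have "G_on J v + h v = m"
      using excess_formula[OF J(1,2) z(1) sub v(1)] v(2,3) by (simp add: m_def)
    then have "\<rho> \<le> M * \<delta> n * norm (p - v)"
      using step_inequality[OF Gv, of n] zero_le_power2[of "norm (A (p - v))"]
      unfolding \<rho>_def p_def M_def by linarith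
    moreover have "0 \<le> \<rho>" using v(4) \<gamma>(1) zero_le_power2[of "norm (p - v)"]
      by (meson mult_nonneg_nonneg less_imp_le order_trans)
    ultimately have "\<rho>\<^sup>2 \<le> (M * \<delta> n * norm (p - v))\<^sup>2" by (intro power_mono)
    then have "\<gamma> * \<rho>\<^sup>2 \<le> \<gamma> * (M * \<delta> n * norm (p - v))\<^sup>2" using \<gamma>(1) by simp
    also have "\<dots> = (M * \<delta> n)\<^sup>2 * (\<gamma> * (norm (p - v))\<^sup>2)" by (simp add: power_mult_distrib mult_ac)
    also have "\<dots> \<le> (M * \<delta> n)\<^sup>2 * \<rho>" using v(4) by (intro mult_left_mono) auto
    finally have "\<gamma> * \<rho> * \<rho> \<le> (M * \<delta> n)\<^sup>2 * \<rho>" by (simp add: power2_eq_square mult_ac)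
    then have "\<gamma> * \<rho> \<le> (M * \<delta> n)\<^sup>2" using \<open>0 \<le> \<rho>\<close> by (cases "\<rho> = 0") auto
    then have "\<rho> \<le> K * (\<kappa> * (\<delta> n)\<^sup>2)"
      using \<gamma>(1) \<kappa>_pos by (simp add: K_def power_mult_distrib field_simps)
    also have "\<dots> \<le> K * ((g + h (x n) - m) - \<rho>)"
      using descent[OF g] \<open>0 < K\<close> unfolding \<rho>_def by (intro mult_left_mono) auto
    finally show ?thesis using \<open>0 < K\<close> unfolding \<epsilon>_def \<rho>_def[symmetric] by (simp add: field_simps)
  qed
  show thesis
    by (rule that[OF J z(1) sub, of \<epsilon>]) (use \<open>0 < K\<close> rate in \<open>auto simp: \<epsilon>_def m_def\<close>)
qed

text \<open>
  If the objective is infinite at \<open>x 0\<close>, the bound on the values is void; the bound on the iterates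
  does not see \<open>x 0\<close>, because its constant \<open>C\<close> is taken from the excess at \<open>x 1\<close>.
\<close>

theorem linear_convergence:
  "\<exists>xbar. is_arg_min (\<lambda>u. G u + ereal (h u)) (\<lambda>_. True) xbar \<and> x \<longlonglongrightarrow> xbar \<and>
    (\<exists>\<epsilon> C :: real. 0 < \<epsilon> \<and> \<epsilon> < 1 \<and> 0 < C \<and>
      (\<forall>n\<ge>1.
        G (x n) + ereal (h (x n)) - (INF u. G u + ereal (h u))
          \<le> ereal (\<epsilon> ^ n) * (G (x 0) + ereal (h (x 0)) - (INF u. G u + ereal (h u))) \<and>
        norm (x (Suc n) - xbar) \<le> C * sqrt \<epsilon> ^ n))"
proof -
  obtain J z \<epsilon> where J: "finite J" "J \<subseteq> N" "\<And>n. x (Suc n) \<in> supported J"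
    and z: "z \<in> supported J" "subgradient (- D z) z" and \<epsilon>: "0 < \<epsilon>" "\<epsilon> < 1"
    and rate: "\<And>n g. G (x n) = ereal g \<Longrightarrow>
      f (Suc n) - (G_on J z + h z) \<le> \<epsilon> * (g + h (x n) - (G_on J z + h z))"
    by (rule linear_rate) (rule that)
  define m where "m = G_on J z + h z"
  have G_J: "G u = ereal (G_on J u)" if "u \<in> supported J" for u by (rule G_supported[OF J(1,2) that])
  have m_le: "ereal m \<le> G u + ereal (h u)" for u
    unfolding m_def by (rule stationary_minimizes[OF J(1,2) z])
  have inf_eq: "(INF u. G u + ereal (h u)) = ereal m"
  proof (rule antisym)
    have "(INF u. G u + ereal (h u)) \<le> G z + ereal (h z)" by (rule INF_lower) simp
    then show "(INF u. G u + ereal (h u)) \<le> ereal m" by (simp add: G_J z m_def)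
    show "ereal m \<le> (INF u. G u + ereal (h u))" by (rule INF_greatest) (rule m_le)
  qed
  have obj: "G (x (Suc n)) + ereal (h (x (Suc n))) = ereal (f (Suc n))" for n
    by (simp add: G_iterate)
  have f_ge: "0 \<le> f (Suc n) - m" for n using m_le[of "x (Suc n)"] by (simp add: obj)
  have rate_Suc: "f (Suc (Suc n)) - m \<le> \<epsilon> * (f (Suc n) - m)" for n
    using rate[OF G_iterate, of n] by (simp add: m_def)
  have rate1: "f (Suc n) - m \<le> \<epsilon> ^ n * (f (Suc 0) - m)" for n
  proof (induction n)
    case (Suc n)
    have "f (Suc (Suc n)) - m \<le> \<epsilon> * (f (Suc n) - m)" by (rule rate_Suc)
    also have "\<dots> \<le> \<epsilon> * (\<epsilon> ^ n * (f (Suc 0) - m))" using Suc \<epsilon> by (intro mult_left_mono) auto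
    finally show ?case by simp
  qed simp
  have value_rate: "G (x n) + ereal (h (x n)) - ereal m
      \<le> ereal (\<epsilon> ^ n) * (G (x 0) + ereal (h (x 0)) - ereal m)" if "1 \<le> n" for n
  proof (cases "G (x 0)")
    case (real g)
    obtain i where n: "n = Suc i" using \<open>1 \<le> n\<close> by (cases n) auto
    have "f (Suc 0) - m \<le> \<epsilon> * (g + h (x 0) - m)" using rate[OF real] by (simp add: m_def)
    then have "\<epsilon> ^ i * (f (Suc 0) - m) \<le> \<epsilon> ^ i * (\<epsilon> * (g + h (x 0) - m))"
      using \<epsilon> by (intro mult_left_mono) auto
    with rate1[of i] have "f (Suc i) - m \<le> \<epsilon> ^ n * (g + h (x 0) - m)" by (simp add: n mult_ac)
    then show ?thesis unfolding n obj real by simp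
  next
    case PInf
    then show ?thesis using \<epsilon> by simp
  next
    case MInf
    then show ?thesis using G_nonneg[of "x 0"] by simp
  qed
  define s where "s = sqrt \<epsilon>"
  have s: "0 \<le> s" "s < 1" using \<epsilon> by (auto simp: s_def)
  define C0 where "C0 = sqrt ((f (Suc 0) - m) / \<kappa>)"
  have step: "norm (x (Suc (Suc n)) - x (Suc n)) \<le> C0 * s ^ n" for n
  proof -
    have "\<kappa> * (\<delta> (Suc n))\<^sup>2 \<le> \<epsilon> ^ n * (f (Suc 0) - m)"
      using descent_Suc[of n] f_ge[of "Suc n"] rate1[of n] by linarith
    then have "(\<delta> (Suc n))\<^sup>2 \<le> (f (Suc 0) - m) / \<kappa> * \<epsilon> ^ n"
      using \<kappa>_pos by (simp add: field_simps)
    then have "\<delta> (Suc n) \<le> sqrt ((f (Suc 0) - m) / \<kappa> * \<epsilon> ^ n)" by (rule real_le_rsqrt)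
    then show ?thesis by (simp only: \<delta>_def C0_def s_def real_sqrt_mult real_sqrt_power)
  qed
  obtain xbar where xbar: "(\<lambda>n. x (Suc n)) \<longlonglongrightarrow> xbar"
    "\<And>n. norm (x (Suc n) - xbar) \<le> C0 / (1 - s) * s ^ n"
    by (rule geometric_steps_converge[of "\<lambda>n. x (Suc n)", OF step s]) (rule that)
  have "xbar \<in> supported J" by (rule closed_sequentially[OF closed_supported _ xbar(1)]) (rule J)
  have "(\<lambda>n. f (Suc n)) \<longlonglongrightarrow> G_on J xbar + h xbar"
  proof -
    have "(\<lambda>n. \<sigma> k (x (Suc n) \<bullet> e k)) \<longlonglongrightarrow> \<sigma> k (xbar \<bullet> e k)" for k
      by (rule continuous_on_tendsto_compose[OF continuous_\<sigma> tendsto_inner[OF xbar(1) tendsto_const]])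
        auto
    then have "(\<lambda>n. G_on J (x (Suc n)) + h (x (Suc n))) \<longlonglongrightarrow> G_on J xbar + h xbar"
      unfolding G_on_def least_squares_def by (intro tendsto_intros A.tendsto xbar)
    then show ?thesis using G_J[OF J(3)] by (simp add: f_def)
  qed
  moreover have "(\<lambda>n. m + \<epsilon> ^ n * (f (Suc 0) - m)) \<longlonglongrightarrow> m + 0 * (f (Suc 0) - m)"
    using \<epsilon> by (intro tendsto_intros LIMSEQ_realpow_zero) auto
  ultimately have "G_on J xbar + h xbar \<le> m + 0 * (f (Suc 0) - m)"
    by (rule LIMSEQ_le) (use rate1 in \<open>auto simp: algebra_simps\<close>)
  then have "G xbar + ereal (h xbar) \<le> ereal m" by (simp add: G_J[OF \<open>xbar \<in> supported J\<close>])
  then have min: "is_arg_min (\<lambda>u. G u + ereal (h u)) (\<lambda>_. True) xbar"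
    unfolding is_arg_min_linorder using m_le order_trans by blast
  define C where "C = C0 / (1 - s) + 1"
  have "0 \<le> C0 / (1 - s)" using s f_ge[of 0] \<kappa>_pos by (simp add: C0_def)
  then have "0 < C" by (simp add: C_def)
  have "norm (x (Suc n) - xbar) \<le> C * sqrt \<epsilon> ^ n" for n
  proof -
    have "C0 / (1 - s) * s ^ n \<le> C * s ^ n" using s by (intro mult_right_mono) (auto simp: C_def)
    then show ?thesis using xbar(2)[of n] unfolding s_def by linarith
  qed
  then show ?thesis
    using min LIMSEQ_imp_Suc[OF xbar(1)] \<epsilon> \<open>0 < C\<close> value_rate unfolding inf_eq by blast
qed

end

theorem theorem4p8:
  fixes N :: "nat set"
    and e :: "nat \<Rightarrow> 'a :: {real_inner, polish_space}"
    and A :: "'a \<Rightarrow> 'b :: {real_inner, polish_space}"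
    and y :: 'b
    and I :: "nat \<Rightarrow> real set"
    and L lam :: real
    and x :: "nat \<Rightarrow> 'a"
  assumes "orthonormal_basis N e"
    and "bounded_linear A"
    and "\<forall>k\<in>N. is_interval (I k) \<and> closed (I k) \<and> bounded (I k)"
    and "\<exists>\<omega>>0. \<forall>k\<in>N. {-\<omega>..\<omega>} \<subseteq> I k"
    and "L > 0"
    and "L-lipschitz_on UNIV (gradient (least_squares A y))"
    and "0 < lam" and "lam < 2 / L"
    and "\<forall>n. x (Suc n) =
           prox lam (norm_1I N e I) (x n - lam *\<^sub>R gradient (least_squares A y) (x n))"
  shows "\<exists>xbar. is_arg_min (objective N e I A y) (\<lambda>_. True) xbar \<and> x \<longlonglongrightarrow> xbar \<and>
    (\<exists>\<epsilon> C :: real. 0 < \<epsilon> \<and> \<epsilon> < 1 \<and> 0 < C \<and>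
      (\<forall>n\<ge>1.
        objective N e I A y (x n) - (INF z. objective N e I A y z)
          \<le> ereal (\<epsilon> ^ n) * (objective N e I A y (x 0) - (INF z. objective N e I A y z)) \<and>
        norm (x (Suc n) - xbar) \<le> C * sqrt \<epsilon> ^ n))"
proof -
  obtain \<omega> where \<omega>: "0 < \<omega>" "\<And>k. k \<in> N \<Longrightarrow> {-\<omega>..\<omega>} \<subseteq> I k" using assms(4) by blast
  have "\<exists>l u. I k = {l..u}" if "k \<in> N" for k
  proof -
    have "connected (I k)" "compact (I k)"
      using assms(3) that by (auto simp: is_interval_connected compact_eq_bounded_closed)
    then show ?thesis using connected_compact_interval_1[of "I k"] by (auto simp: cbox_interval)
  qed
  then obtain a b where I: "\<And>k. k \<in> N \<Longrightarrow> I k = {a k..b k}" by metis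
  have bounds: "a k \<le> - \<omega>" "\<omega> \<le> b k" if "k \<in> N" for k
    using \<omega>(1) \<omega>(2)[OF that] I[OF that] by auto
  have G: "norm_1I N e I = norm_1I N e (\<lambda>k. {a k..b k})"
    unfolding norm_1I_def by (intro ext infsum_cong) (simp add: I)
  interpret A: bounded_linear A by (rule assms(2))
  interpret iterative_thresholding N e a b \<omega> A y L lam x
    by unfold_locales (use assms \<omega>(1) bounds in \<open>auto simp: G\<close>)
  show ?thesis using linear_convergence unfolding objective_def[abs_def] G .
qed

end
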